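(* Let $X$ be a nearly uniformly convex (NUC) Banach space and let $(A,B)$ be a pair of nonempty bounded closed convex subsets of $X$ which is a proximal parallel pair. Assume that $(A,B)$ has the rectangle property and the property $UC$. Let $T: A\cup B \to A\cup B$ be a continuous and asymptotically relatively nonexpansive map satisfying $T(A)\subseteq B$ and $T(B)\subseteq A$. Then there exists $x\in A\cup B$ such that $\|x-Tx\| = \operatorname{dist}(A,B)$.
   Context: For nonempty subsets $A,B$ of a Banach space $X$, $\operatorname{dist}(A,B)=\inf\{\|a-b\|: a\in A,\ b\in B\}$. A Banach space $X$ has uniformly Kadec-Klee (UKK) norm if for every $\epsilon>0$ there is $\delta>0$ such that whenever $\{x_n\}$ is a sequence in the closed unit ball of $X$ converging weakly to $x_0$ with $\inf\{\|x_n-x_m\|: n\neq m\}>\epsilon$, then $\|x_0\|\le 1-\delta$. $X$ is nearly uniformly convex (NUC) if it is reflexive and has UKK norm. The pair $(A,B)$ is a proximal pair if for each $(x,y)\in A\times B$ there is $(x_1,y_1)\in A\times B$ with $\|x-y_1\|=\operatorname{dist}(A,B)=\|y-x_1\|$. It is a sharp proximal pair if in addition, for each $(x,y)\in A\times B$, such a pair $(x_1,y_1)$ is unique. It is a proximal parallel pair if it is a sharp proximal pair and there is a unique $h\in X$ with $B=A+h$; in this case, for $a\in A$, $a+h$ is the proximal point in $B$ to $a$ (so $\|h\|=\operatorname{dist}(A,B)$). A convex proximal parallel pair $(A,B)$ with $B=A+h$ has the rectangle property if $\|x+h-y\|=\|y+h-x\|$ for all $x,y\in A$. $(A,B)$ has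 the property $UC$ if whenever $\{x_n\},\{z_n\}$ are sequences in $A$ and $\{y_n\}$ is a sequence in $B$ with $\lim\|x_n-y_n\|=\operatorname{dist}(A,B)$ and $\lim\|z_n-y_n\|=\operatorname{dist}(A,B)$, then $\lim\|x_n-z_n\|=0$. A map $T:A\cup B\to A\cup B$ is asymptotically relatively nonexpansive if there is a sequence $\{k_n\}$ in $[1,\infty)$ with $\lim k_n=1$ and $\|T^nx-T^ny\|\le k_n\|x-y\|$ for all $x\in A$, $y\in B$ and $n\in\mathbb{N}$. *)

theory Defs
  imports "HOL-Analysis.Analysis"
begin

text \<open>For nonempty sets, the distance between \<open>A\<close> and \<open>B\<close> is the library's \<^const>\<open>setdist\<close>.\<close>

definition weakly_converges ::
    "(nat \<Rightarrow> 'a::real_normed_vector) \<Rightarrow> 'a \<Rightarrow> bool" where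
  "weakly_converges x l \<longleftrightarrow>
     (\<forall>f :: 'a \<Rightarrow>\<^sub>L real. (\<lambda>n. blinfun_apply f (x n)) \<longlonglongrightarrow> blinfun_apply f l)"

lift_definition bidual_embedding ::
    "'a::real_normed_vector \<Rightarrow> ('a \<Rightarrow>\<^sub>L real) \<Rightarrow>\<^sub>L real"
  is "\<lambda>x f. blinfun_apply f x"
  by (rule blinfun.bounded_linear_left)

definition reflexive_space :: "'a::real_normed_vector itself \<Rightarrow> bool" where
  "reflexive_space _ \<longleftrightarrow> surj (bidual_embedding :: 'a \<Rightarrow> ('a \<Rightarrow>\<^sub>L real) \<Rightarrow>\<^sub>L real)"

definition UKK_norm :: "'a::real_normed_vector itself \<Rightarrow> bool" where
  "UKK_norm _ \<longleftrightarrow>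
     (\<forall>\<epsilon>>0. \<exists>\<delta>>0. \<forall>(x :: nat \<Rightarrow> 'a) x0.
        range x \<subseteq> cball 0 1 \<longrightarrow> weakly_converges x x0 \<longrightarrow>
        Inf {norm (x n - x m) |n m. n \<noteq> m} > \<epsilon> \<longrightarrow> norm x0 \<le> 1 - \<delta>)"

definition NUC_space :: "'a::real_normed_vector itself \<Rightarrow> bool" where
  "NUC_space X \<longleftrightarrow> reflexive_space X \<and> UKK_norm X"

definition proximal_pair :: "'a::real_normed_vector set \<Rightarrow> 'a set \<Rightarrow> bool" where
  "proximal_pair A B \<longleftrightarrow>
     (\<forall>x\<in>A. \<forall>y\<in>B. \<exists>x1\<in>A. \<exists>y1\<in>B.
        norm (x - y1) = setdist A B \<and> norm (y - x1) = setdist A B)"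

definition sharp_proximal_pair :: "'a::real_normed_vector set \<Rightarrow> 'a set \<Rightarrow> bool" where
  "sharp_proximal_pair A B \<longleftrightarrow> proximal_pair A B \<and>
     (\<forall>x\<in>A. \<forall>y\<in>B. \<exists>!p. p \<in> A \<times> B \<and>
        norm (x - snd p) = setdist A B \<and> norm (y - fst p) = setdist A B)"

text \<open>That \<open>a + h\<close> is the proximal point of \<open>a\<close>, and hence \<open>norm h = setdist A B\<close>, is not
  required here: for nonempty bounded convex pairs it follows from the definition.\<close>

definition proximal_parallel_pair :: "'a::real_normed_vector set \<Rightarrow> 'a set \<Rightarrow> bool" where
  "proximal_parallel_pair A B \<longleftrightarrow>
     sharp_proximal_pair A B \<and> (\<exists>!h. B = (\<lambda>a. a + h) ` A)"

text \<open>Only meaningful for a convex proximal parallel pair, where the vector \<open>h\<close> is unique.\<close>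

definition rectangle_property :: "'a::real_normed_vector set \<Rightarrow> 'a set \<Rightarrow> bool" where
  "rectangle_property A B \<longleftrightarrow>
     (\<exists>h. B = (\<lambda>a. a + h) ` A \<and>
          (\<forall>x\<in>A. \<forall>y\<in>A. norm (x + h - y) = norm (y + h - x)))"

definition property_UC :: "'a::real_normed_vector set \<Rightarrow> 'a set \<Rightarrow> bool" where
  "property_UC A B \<longleftrightarrow>
     (\<forall>x z y. range x \<subseteq> A \<longrightarrow> range z \<subseteq> A \<longrightarrow> range y \<subseteq> B \<longrightarrow>
        (\<lambda>n::nat. norm (x n - y n)) \<longlonglongrightarrow> setdist A B \<longrightarrow>
        (\<lambda>n. norm (z n - y n)) \<longlonglongrightarrow> setdist A B \<longrightarrow>
        (\<lambda>n. norm (x n - z n)) \<longlonglongrightarrow> 0)"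

definition asymptotically_relatively_nonexpansive ::
    "'a::real_normed_vector set \<Rightarrow> 'a set \<Rightarrow> ('a \<Rightarrow> 'a) \<Rightarrow> bool" where
  "asymptotically_relatively_nonexpansive A B T \<longleftrightarrow>
     (\<exists>k :: nat \<Rightarrow> real. (\<forall>n. k n \<ge> 1) \<and> k \<longlonglongrightarrow> 1 \<and>
        (\<forall>x\<in>A. \<forall>y\<in>B. \<forall>n. norm ((T ^^ n) x - (T ^^ n) y) \<le> k n * norm (x - y)))"

end

theory Submission
  imports Defs "HOL-Complex_Analysis.Great_Picard"
begin

text \<open>
  Let \<open>B = A + h\<close>. On \<open>A\<close> consider the gap \<open>norm (x - h - y)\<close>, the distance from \<open>x\<close> to the
  translate \<open>y + h\<close>. The rectangle property says that the gap is symmetric, and with proximality it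
  forces \<open>norm h = setdist A B\<close>, so the gap is smallest on the diagonal; the property \<open>UC\<close> says that
  points whose gaps tend to this minimum approach each other. Thus the gap is a substitute for the
  norm distance, and moving odd iterates of \<open>T\<close> back by \<open>h\<close> gives maps \<open>c n\<close> from \<open>A\<close> to \<open>A\<close> that
  are asymptotically nonexpansive for it, up to a vanishing error. If \<open>c n x\<close> converges to \<open>x\<close>,
  then comparing even and odd times shows \<open>T x = x + h\<close> by continuity. So an \<open>x\<close> is wanted whose
  orbit has asymptotic gap \<open>norm h\<close> to \<open>x\<close>.

  Such a point is found in a minimal nonempty closed convex set \<open>K\<close> that contains all weak
  subsequential limits of orbits starting in \<open>K\<close>; it exists by Zorn's lemma and weak compactness.
  Minimality makes the asymptotic gap between an orbit and the points of \<open>K\<close> a constant \<open>\<rho>\<close>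
  (\<open>minimal_stable_constant_radius\<close>). Suppose that \<open>\<rho> > norm h\<close>. A separated subsequence of the
  orbit would have a weak limit in \<open>K\<close> whose gap to the orbit is, by the UKK property, strictly
  smaller than \<open>\<rho>\<close> (\<open>minimal_stable_no_separated_subsequence\<close>). Hence the orbit is relatively
  compact, and its norm limit points all lie in \<open>K\<close>. But then an argument of normal structure type,
  with barycentres of finitely many limit points, produces infinitely many separated limit points
  (\<open>minimal_stable_radius_le\<close>). Therefore \<open>\<rho> \<le> norm h\<close>, as wanted.

  The functional analysis behind this is developed from sublinear functionals: the Hahn--Banach
  theorem with separation of points from closed convex sets, weak compactness of bounded closed
  convex sets in a reflexive space, and the extraction of weakly convergent subsequences.
\<close>

section \<open>Sublinear functionals and the Hahn--Banach theorem\<close>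

definition sublinear :: "('a::real_vector \<Rightarrow> real) \<Rightarrow> bool" where
  "sublinear p \<longleftrightarrow> (\<forall>x y. p (x + y) \<le> p x + p y) \<and> (\<forall>t\<ge>0. \<forall>x. p (t *\<^sub>R x) = t * p x)"

lemma sublinear_add: "sublinear p \<Longrightarrow> p (x + y) \<le> p x + p y"
  by (auto simp: sublinear_def)

lemma sublinear_scale: "sublinear p \<Longrightarrow> 0 \<le> t \<Longrightarrow> p (t *\<^sub>R x) = t * p x"
  by (auto simp: sublinear_def)

lemma sublinear_0: "sublinear p \<Longrightarrow> p 0 = 0"
  using sublinear_scale[of p 0 0] by simp

lemma sublinear_minus: "sublinear p \<Longrightarrow> - p (- x) \<le> p x"
  using sublinear_add[of p x "- x"] sublinear_0[of p] by simp

lemma sublinear_norm: "sublinear (norm :: 'a::real_normed_vector \<Rightarrow> real)"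
  by (auto simp: sublinear_def norm_triangle_ineq)

text \<open>The infimal convolution of \<open>p\<close> with the cone over \<open>C\<close>, tilted by \<open>d\<close>. With \<open>C\<close> a
  singleton it shows that a minimal sublinear functional is odd; with a general convex \<open>C\<close> it turns
  a lower bound of \<open>p\<close> on \<open>C\<close> into a lower bound for a linear functional.\<close>

lemma sublinear_tilt:
  fixes p :: "'a::real_vector \<Rightarrow> real"
  assumes p: "sublinear p" and C: "convex C" "C \<noteq> {}" and d: "\<And>c. c \<in> C \<Longrightarrow> d \<le> p c"
  shows "\<exists>q. sublinear q \<and> (\<forall>x. q x \<le> p x) \<and> (\<forall>c\<in>C. q (- c) \<le> - d)"
proof -
  define S where "S x = (\<lambda>(t, c). p (x + t *\<^sub>R c) - t * d) ` ({0..} \<times> C)" for x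
  define q where "q x = Inf (S x)" for x
  have mem: "p (x + t *\<^sub>R c) - t * d \<in> S x" if "0 \<le> t" "c \<in> C" for x t c
    using that by (force simp: S_def)
  have ne: "S x \<noteq> {}" for x using C(2) by (auto simp: S_def)
  have lb: "- p (- x) \<le> s" if "s \<in> S x" for x s
  proof -
    obtain t c where t: "0 \<le> t" "c \<in> C" "s = p (x + t *\<^sub>R c) - t * d"
      using \<open>s \<in> S x\<close> by (auto simp: S_def)
    have "t * d \<le> p (t *\<^sub>R c)"
      using t d sublinear_scale[OF p] by (simp add: mult_left_mono)
    also have "\<dots> \<le> p (x + t *\<^sub>R c) + p (- x)"
      using sublinear_add[OF p, of "x + t *\<^sub>R c" "- x"] by simp
    finally show ?thesis using t by simp
  qed
  have bdd: "bdd_below (S x)" for x using lb by (meson bdd_belowI)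
  have qle: "q x \<le> p (x + t *\<^sub>R c) - t * d" if "0 \<le> t" "c \<in> C" for x t c
    unfolding q_def by (rule cInf_lower[OF mem[OF that] bdd])
  have qge: "u \<le> q x" if "\<And>t c. 0 \<le> t \<Longrightarrow> c \<in> C \<Longrightarrow> u \<le> p (x + t *\<^sub>R c) - t * d" for u x
    unfolding q_def by (rule cInf_greatest[OF ne]) (use that in \<open>auto simp: S_def\<close>)
  have add1: "q (x + y) \<le> (p (x + t *\<^sub>R c) - t * d) + (p (y + s *\<^sub>R e) - s * d)"
    if h: "0 \<le> t" "c \<in> C" "0 \<le> s" "e \<in> C" for x y t c s e
  proof -
    have "\<exists>b\<in>C. (t + s) *\<^sub>R b = t *\<^sub>R c + s *\<^sub>R e"
    proof (cases "t + s = 0")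
      case True
      then have "t = 0" "s = 0" using h by auto
      then show ?thesis using h by auto
    next
      case False
      have "(t / (t + s)) *\<^sub>R c + (s / (t + s)) *\<^sub>R e \<in> C"
        using h False by (intro convexD[OF C(1)]) (auto simp: add_divide_distrib[symmetric])
      moreover have "(t + s) *\<^sub>R ((t / (t + s)) *\<^sub>R c + (s / (t + s)) *\<^sub>R e) = t *\<^sub>R c + s *\<^sub>R e"
        using False by (simp add: scaleR_right_distrib)
      ultimately show ?thesis by blast
    qed
    then obtain b where b: "b \<in> C" "(t + s) *\<^sub>R b = t *\<^sub>R c + s *\<^sub>R e" by blast
    have "q (x + y) \<le> p ((x + y) + (t + s) *\<^sub>R b) - (t + s) * d"
      using h b by (intro qle) auto
    also have "(x + y) + (t + s) *\<^sub>R b = (x + t *\<^sub>R c) + (y + s *\<^sub>R e)"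
      unfolding b(2) by (simp add: algebra_simps)
    also have "p \<dots> \<le> p (x + t *\<^sub>R c) + p (y + s *\<^sub>R e)" by (rule sublinear_add[OF p])
    finally show ?thesis by (simp add: algebra_simps)
  qed
  have add: "q (x + y) \<le> q x + q y" for x y
  proof -
    have "q (x + y) - q y \<le> q x"
    proof (rule qge)
      fix t c assume tc: "0 \<le> (t::real)" "c \<in> C"
      have "q (x + y) - (p (x + t *\<^sub>R c) - t * d) \<le> q y"
        by (rule qge) (use add1[OF tc] in \<open>fastforce simp: algebra_simps\<close>)
      then show "q (x + y) - q y \<le> p (x + t *\<^sub>R c) - t * d" by simp
    qed
    then show ?thesis by simp
  qed
  have scale_le: "q (r *\<^sub>R x) \<le> r * q x" if r: "0 < r" for r x
  proof -
    have "q (r *\<^sub>R x) / r \<le> q x"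
    proof (rule qge)
      fix t c assume tc: "0 \<le> (t::real)" "c \<in> C"
      have "q (r *\<^sub>R x) \<le> p (r *\<^sub>R x + (r * t) *\<^sub>R c) - (r * t) * d"
        using r tc by (intro qle) auto
      also have "r *\<^sub>R x + (r * t) *\<^sub>R c = r *\<^sub>R (x + t *\<^sub>R c)" by (simp add: scaleR_right_distrib)
      also have "p \<dots> = r * p (x + t *\<^sub>R c)" using r by (intro sublinear_scale[OF p]) auto
      finally have "q (r *\<^sub>R x) \<le> r * (p (x + t *\<^sub>R c) - t * d)" by (simp add: algebra_simps)
      then show "q (r *\<^sub>R x) / r \<le> p (x + t *\<^sub>R c) - t * d"
        using r by (simp add: field_simps)
    qed
    then show ?thesis using r by (simp add: field_simps)
  qed
  have qp: "q x \<le> p x" for x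
    using C(2) qle[of 0 _ x] by auto
  have q0: "q 0 = 0"
    using qp[of 0] qge[of 0 0] lb[OF mem, of _ _ 0] sublinear_0[OF p] by fastforce
  have scale: "q (r *\<^sub>R x) = r * q x" if "0 \<le> r" for r x
  proof (cases "r = 0")
    case False
    then have r: "0 < r" using that by simp
    have "q (inverse r *\<^sub>R (r *\<^sub>R x)) \<le> inverse r * q (r *\<^sub>R x)"
      using r by (intro scale_le) simp
    then have "r * q x \<le> q (r *\<^sub>R x)" using r by (simp add: field_simps)
    with scale_le[OF r, of x] show ?thesis by simp
  qed (simp add: q0)
  have "q (- c) \<le> - d" if "c \<in> C" for c
    using qle[of 1 c "- c"] that sublinear_0[OF p] by simp
  then show ?thesis using add scale qp by (intro exI[of _ q]) (auto simp: sublinear_def)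
qed

lemma exists_minimal_sublinear:
  fixes p :: "'a::real_vector \<Rightarrow> real"
  assumes p: "sublinear p"
  shows "\<exists>m. sublinear m \<and> m \<le> p \<and> (\<forall>q. sublinear q \<longrightarrow> q \<le> m \<longrightarrow> q = m)"
proof -
  define Q where "Q = {q. sublinear q \<and> q \<le> p}"
  let ?R = "relation_of (\<lambda>f g. g \<le> f) Q"
  have po: "partial_order_on Q ?R"
    by (rule partial_order_on_relation_ofI) (auto intro: order.trans)
  have "\<exists>m\<in>Q. \<forall>a\<in>Q. a \<le> m \<longrightarrow> a = m"
  proof (rule predicate_Zorn[OF po])
    fix K assume K: "K \<in> Chains ?R"
    show "\<exists>u\<in>Q. \<forall>a\<in>K. u \<le> a"
    proof (cases "K = {}")
      case True
      then show ?thesis using p by (auto simp: Q_def)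
    next
      case False
      have KQ: "sublinear q" "q \<le> p" if "q \<in> K" for q
        using that K by (auto simp: Chains_def relation_of_def Q_def)
      have chain: "f \<le> g \<or> g \<le> f" if "f \<in> K" "g \<in> K" for f g
        using that K by (auto simp: Chains_def relation_of_def)
      define u where "u x = (INF f\<in>K. f x)" for x
      have lb: "- p (- x) \<le> f x" if "f \<in> K" for f x
        using sublinear_minus[OF KQ(1)[OF that], of x] KQ(2)[OF that]
        by (meson le_fun_def neg_le_iff_le order.trans)
      have bdd: "bdd_below ((\<lambda>f. f x) ` K)" for x
        using lb by (intro bdd_belowI[of _ "- p (- x)"]) auto
      have ule: "u x \<le> f x" if "f \<in> K" for f x
        unfolding u_def using that by (intro cINF_lower bdd)
      have uge: "b \<le> u x" if "\<And>f. f \<in> K \<Longrightarrow> b \<le> f x" for b x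
        unfolding u_def using that False by (intro cINF_greatest)
      have "u (x + y) \<le> u x + u y" for x y
      proof -
        have uadd: "u (x + y) \<le> f x + g y" if fg: "f \<in> K" "g \<in> K" for f g
        proof -
          obtain e where e: "e \<in> K" "e \<le> f" "e \<le> g" using chain[OF fg] fg by blast
          have "u (x + y) \<le> e x + e y"
            using ule[OF e(1), of "x + y"] sublinear_add[OF KQ(1)[OF e(1)], of x y] by simp
          moreover have "e x \<le> f x" "e y \<le> g y" using e by (auto dest: le_funD)
          ultimately show ?thesis by linarith
        qed
        have "u (x + y) - f x \<le> u y" if f: "f \<in> K" for f
        proof (rule uge)
          fix g assume "g \<in> K"
          then show "u (x + y) - f x \<le> g y" using uadd[OF f, of g] by simp
        qed
        then have "u (x + y) - u y \<le> u x"
          by (intro uge) (simp add: algebra_simps)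
        then show ?thesis by simp
      qed
      moreover have "u (t *\<^sub>R x) = t * u x" if "0 \<le> t" for t x
      proof (cases "t = 0")
        case True
        then show ?thesis
          using False by (simp add: u_def KQ(1)[THEN sublinear_0] cong: INF_cong)
      next
        case t: False
        show ?thesis
        proof (rule antisym)
          have "u (t *\<^sub>R x) / t \<le> u x"
          proof (rule uge)
            fix f assume "f \<in> K"
            then show "u (t *\<^sub>R x) / t \<le> f x"
              using ule[of f "t *\<^sub>R x"] sublinear_scale[OF KQ(1), of f t x] that t
              by (simp add: field_simps)
          qed
          then show "u (t *\<^sub>R x) \<le> t * u x" using that t by (simp add: field_simps)
          show "t * u x \<le> u (t *\<^sub>R x)"
            by (rule uge) (simp add: sublinear_scale[OF KQ(1)] that mult_left_mono ule)
        qed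
      qed
      moreover have "u \<le> p"
        using False ule KQ(2) by (meson all_not_in_conv le_funI le_funD order.trans)
      ultimately show ?thesis
        using ule by (intro bexI[of _ u]) (auto simp: Q_def sublinear_def le_fun_def)
    qed
  qed
  then show ?thesis unfolding Q_def by (auto intro: order.trans)
qed

text \<open>A minimal sublinear functional \<open>m\<close> satisfies \<open>m (- y) = - m y\<close>, for tilting it along \<open>y\<close>
  would otherwise make it smaller; subadditivity and oddness together give additivity.\<close>

theorem Hahn_Banach_sublinear:
  fixes p :: "'a::real_vector \<Rightarrow> real"
  assumes p: "sublinear p"
  shows "\<exists>f. linear f \<and> (\<forall>x. f x \<le> p x)"
proof -
  obtain m where m: "sublinear m" "m \<le> p" and min: "\<And>q. sublinear q \<Longrightarrow> q \<le> m \<Longrightarrow> q = m"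
    using exists_minimal_sublinear[OF p] by blast
  have odd: "m (- y) = - m y" for y
  proof -
    obtain q where q: "sublinear q" "\<forall>x. q x \<le> m x" "q (- y) \<le> - m y"
      using sublinear_tilt[OF m(1), of "{y}" "m y"] by auto
    have "q = m" using min q by (simp add: le_fun_def)
    then show ?thesis using q(3) sublinear_minus[OF m(1), of y] by simp
  qed
  have "linear m"
  proof (rule linearI)
    fix x y
    have "m x \<le> m (x + y) + m (- y)" using sublinear_add[OF m(1), of "x + y" "- y"] by simp
    then show "m (x + y) = m x + m y" using sublinear_add[OF m(1), of x y] odd[of y] by simp
  next
    fix r :: real and x
    show "m (r *\<^sub>R x) = r *\<^sub>R m x"
    proof (cases "0 \<le> r")
      case True
      then show ?thesis by (simp add: sublinear_scale[OF m(1)])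
    next
      case False
      then show ?thesis
        using sublinear_scale[OF m(1), of "- r" x] odd[of "r *\<^sub>R x"] by simp
    qed
  qed
  then show ?thesis using m(2) by (auto simp: le_fun_def)
qed

lemma exists_functional_above_on_convex:
  fixes C :: "'a::real_normed_vector set"
  assumes "convex C" "C \<noteq> {}" "\<And>c. c \<in> C \<Longrightarrow> d \<le> norm c"
  shows "\<exists>f :: 'a \<Rightarrow>\<^sub>L real. norm f \<le> 1 \<and> (\<forall>c\<in>C. d \<le> blinfun_apply f c)"
proof -
  obtain q where q: "sublinear q" "\<forall>x::'a. q x \<le> norm x" "\<forall>c\<in>C. q (- c) \<le> - d"
    using sublinear_tilt[OF sublinear_norm assms] by blast
  obtain f where f: "linear f" "\<And>x. f x \<le> q x" using Hahn_Banach_sublinear[OF q(1)] by blast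
  have fn: "f x \<le> norm x" for x using f(2)[of x] q(2)[rule_format, of x] by linarith
  have neg: "f (- x) = - f x" for x by (rule linear_neg[OF f(1)])
  have ab: "\<bar>f x\<bar> \<le> norm x" for x using fn[of x] fn[of "- x"] neg[of x] by simp
  have bl: "bounded_linear f"
    using f(1) ab by (intro bounded_linear_intro[where K = 1]) (auto simp: linear_add linear_scale)
  have ap: "blinfun_apply (Blinfun f) x = f x" for x
    by (simp add: bounded_linear_Blinfun_apply[OF bl])
  have "norm (Blinfun f) \<le> 1" by (rule norm_blinfun_bound) (auto simp: ap ab)
  moreover have "d \<le> f c" if "c \<in> C" for c
    using q(3)[rule_format, OF that] f(2)[of "- c"] neg[of c] by linarith
  ultimately show ?thesis by (intro exI[of _ "Blinfun f"]) (auto simp: ap)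
qed

corollary exists_norming_functional:
  fixes x :: "'a::real_normed_vector"
  shows "\<exists>f :: 'a \<Rightarrow>\<^sub>L real. norm f \<le> 1 \<and> blinfun_apply f x = norm x"
proof -
  obtain f :: "'a \<Rightarrow>\<^sub>L real" where f: "norm f \<le> 1" "norm x \<le> blinfun_apply f x"
    using exists_functional_above_on_convex[of "{x}" "norm x"] by auto
  have "blinfun_apply f x \<le> norm f * norm x" using norm_blinfun[of f x] by simp
  also have "\<dots> \<le> norm x" using f(1) by (simp add: mult_left_le_one_le)
  finally show ?thesis using f by (intro exI[of _ f]) auto
qed

corollary exists_separating_functional:
  fixes C :: "'a::real_normed_vector set"
  assumes C: "convex C" "closed C" "C \<noteq> {}" and z: "z \<notin> C"
  shows "\<exists>(f :: 'a \<Rightarrow>\<^sub>L real) d. d > 0 \<and> (\<forall>c\<in>C. blinfun_apply f z + d \<le> blinfun_apply f c)"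
proof -
  obtain d where d: "d > 0" "ball z d \<inter> C = {}"
    using C(2) z openE[of "- C" z] by (metis ComplI disjoint_eq_subset_Compl open_Compl)
  have far: "d \<le> norm c" if c: "c \<in> (\<lambda>y. y - z) ` C" for c
  proof -
    from c have "c + z \<in> C" by auto
    then have "c + z \<notin> ball z d" using d(2) by blast
    then show ?thesis by (simp add: dist_norm)
  qed
  obtain f :: "'a \<Rightarrow>\<^sub>L real" where "\<forall>c\<in>(\<lambda>y. y - z) ` C. d \<le> blinfun_apply f c"
    using exists_functional_above_on_convex[OF convex_translation_subtract[OF C(1)] _ far] C(3)
    by blast
  then have "\<forall>c\<in>C. blinfun_apply f z + d \<le> blinfun_apply f c" by (auto simp: blinfun.diff_right algebra_simps)
  then show ?thesis using d(1) by blast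
qed

section \<open>Weak convergence and weak compactness\<close>

text \<open>Mazur's theorem: a functional separating the limit from \<open>C\<close> would keep its values along the
  sequence away from its value at the limit.\<close>

lemma weak_limit_in_closed_convex:
  fixes x :: "nat \<Rightarrow> 'a::real_normed_vector"
  assumes w: "weakly_converges x z" and C: "convex C" "closed C"
    and ev: "eventually (\<lambda>n. x n \<in> C) sequentially"
  shows "z \<in> C"
proof (rule ccontr)
  assume "z \<notin> C"
  moreover have "C \<noteq> {}" using ev by (auto simp: eventually_sequentially)
  ultimately obtain f :: "'a \<Rightarrow>\<^sub>L real" and d where f: "d > 0" "\<forall>c\<in>C. blinfun_apply f z + d \<le> blinfun_apply f c"
    using exists_separating_functional[OF C] by blast
  have "(\<lambda>n. blinfun_apply f (x n)) \<longlonglongrightarrow> blinfun_apply f z" using w by (auto simp: weakly_converges_def)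
  then have "blinfun_apply f z + d \<le> blinfun_apply f z"
    by (rule tendsto_lowerbound) (use ev f in \<open>auto elim: eventually_mono\<close>)
  with f show False by simp
qed

lemma weakly_converges_subseq:
  assumes "weakly_converges x z" "strict_mono r"
  shows "weakly_converges (x \<circ> r) z"
  using assms LIMSEQ_subseq_LIMSEQ[OF _ assms(2)] by (fastforce simp: weakly_converges_def comp_def)

lemma tendsto_imp_weakly_converges:
  fixes x :: "nat \<Rightarrow> 'a::real_normed_vector"
  assumes "x \<longlonglongrightarrow> z"
  shows "weakly_converges x z"
  unfolding weakly_converges_def using assms by (auto intro: blinfun.tendsto)

lemma weakly_converges_diff_const:
  assumes "weakly_converges x z"
  shows "weakly_converges (\<lambda>n. x n - c) (z - c)"
  using assms unfolding weakly_converges_def by (auto simp: blinfun.diff_right intro: tendsto_diff)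

text \<open>Weak compactness: evaluation embeds the bounded set \<open>S\<close> into a product of compact intervals
  indexed by the dual space. A point in the closure of the image is again a bounded linear
  functional on the dual, hence by reflexivity an evaluation, and separation puts the evaluated
  point into every set of the family.\<close>

theorem reflexive_closed_convex_fip:
  fixes \<F> :: "'a::real_normed_vector set set"
  assumes refl: "reflexive_space TYPE('a)" and S: "S \<in> \<F>" "bounded S"
    and cc: "\<And>C. C \<in> \<F> \<Longrightarrow> closed C \<and> convex C"
    and fip: "\<And>\<G>. finite \<G> \<Longrightarrow> \<G> \<subseteq> \<F> \<Longrightarrow> S \<inter> \<Inter>\<G> \<noteq> {}"
  shows "\<Inter>\<F> \<noteq> {}"
proof -
  obtain R where R: "\<And>x. x \<in> S \<Longrightarrow> norm x \<le> R" using S(2) by (auto simp: bounded_iff)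
  define ev :: "'a \<Rightarrow> ('a \<Rightarrow>\<^sub>L real) \<Rightarrow> real" where "ev x f = blinfun_apply f x" for x f
  define P :: "(('a \<Rightarrow>\<^sub>L real) \<Rightarrow> real) set" where "P = PiE UNIV (\<lambda>f. {- R * norm f .. R * norm f})"
  have "compactin (product_topology (\<lambda>_. euclidean) UNIV) P"
    unfolding P_def by (subst compactin_PiE) auto
  then have cP: "compact P" by (simp add: euclidean_product_topology)
  have evP: "ev x \<in> P" if "x \<in> S" for x
  proof -
    have "\<bar>blinfun_apply f x\<bar> \<le> R * norm f" for f :: "'a \<Rightarrow>\<^sub>L real"
    proof -
      have "\<bar>blinfun_apply f x\<bar> \<le> norm f * norm x" using norm_blinfun[of f x] by simp
      also have "\<dots> \<le> norm f * R" using R[OF that] by (intro mult_left_mono) auto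
      finally show ?thesis by (simp add: mult.commute)
    qed
    then show ?thesis by (auto simp: P_def ev_def abs_le_iff minus_le_iff)
  qed
  define lin where "lin = {\<phi> :: ('a \<Rightarrow>\<^sub>L real) \<Rightarrow> real.
      (\<forall>f g. \<phi> (f + g) = \<phi> f + \<phi> g) \<and> (\<forall>r f. \<phi> (r *\<^sub>R f) = r * \<phi> f)}"
  have "closed lin"
    unfolding lin_def
    by (intro closed_Collect_conj closed_Collect_all closed_Collect_eq continuous_intros
        continuous_on_product_coordinates)
  have evlin: "ev x \<in> lin" for x by (simp add: lin_def ev_def blinfun.add_left blinfun.scaleR_left)
  have "P \<inter> \<Inter> ((\<lambda>C. closure (ev ` C)) ` \<F>) \<noteq> {}"
  proof (rule compact_imp_fip_image[OF cP])
    fix \<G> assume "finite \<G>" "\<G> \<subseteq> \<F>"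
    then obtain x where "x \<in> S" "x \<in> \<Inter>\<G>" using fip by blast
    then have "ev x \<in> P" "\<And>C. C \<in> \<G> \<Longrightarrow> ev x \<in> closure (ev ` C)"
      using evP closure_subset[of "ev ` _"] by blast+
    then show "P \<inter> (\<Inter>C\<in>\<G>. closure (ev ` C)) \<noteq> {}" by blast
  qed simp
  then obtain \<phi> where phiP: "\<phi> \<in> P" and phi: "\<And>C. C \<in> \<F> \<Longrightarrow> \<phi> \<in> closure (ev ` C)" by blast
  have "closure (ev ` S) \<subseteq> lin"
    using \<open>closed lin\<close> evlin by (intro closure_minimal) auto
  then have philin: "\<phi> \<in> lin" using phi[OF S(1)] by blast
  have "\<bar>\<phi> f\<bar> \<le> norm f * R" for f
    using phiP by (auto simp: P_def PiE_iff abs_le_iff minus_le_iff mult.commute)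
  then have "bounded_linear \<phi>"
    using philin by (intro bounded_linear_intro[where K = R]) (auto simp: lin_def)
  then obtain \<Phi> :: "('a \<Rightarrow>\<^sub>L real) \<Rightarrow>\<^sub>L real" where Phi: "blinfun_apply \<Phi> = \<phi>"
    by (metis bounded_linear_Blinfun_apply)
  obtain z where z: "\<Phi> = bidual_embedding z"
    using refl unfolding reflexive_space_def by (metis surjD)
  have pz: "\<phi> f = blinfun_apply f z" for f by (simp add: Phi[symmetric] z bidual_embedding.rep_eq)
  have "z \<in> C" if C: "C \<in> \<F>" for C
  proof (rule ccontr)
    assume "z \<notin> C"
    moreover have "C \<noteq> {}" using fip[of "{C}"] C by auto
    ultimately obtain f :: "'a \<Rightarrow>\<^sub>L real" and d where f: "d > 0" "\<forall>c\<in>C. blinfun_apply f z + d \<le> blinfun_apply f c"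
      using exists_separating_functional[of C z] cc[OF C] by blast
    have "closed {\<psi> :: ('a \<Rightarrow>\<^sub>L real) \<Rightarrow> real. blinfun_apply f z + d \<le> \<psi> f}"
      by (intro closed_Collect_le continuous_intros continuous_on_product_coordinates)
    then have "closure (ev ` C) \<subseteq> {\<psi>. blinfun_apply f z + d \<le> \<psi> f}"
      using f(2) by (intro closure_minimal) (auto simp: ev_def)
    then have "blinfun_apply f z + d \<le> \<phi> f" using phi[OF C] by blast
    then show False using pz f(1) by simp
  qed
  then show ?thesis by blast
qed

text \<open>The common point takes the part of a weak cluster point: with closed half-spaces for \<open>C\<close>, the
  statement says that every functional maps it between the limit inferior and the limit superior
  of its values along the sequence.\<close>

lemma reflexive_common_point_of_tails:
  fixes x :: "nat \<Rightarrow> 'a::real_normed_vector"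
  assumes refl: "reflexive_space TYPE('a)" and x: "bounded (range x)"
  shows "\<exists>z. \<forall>C. closed C \<longrightarrow> convex C \<longrightarrow> eventually (\<lambda>n. x n \<in> C) sequentially \<longrightarrow> z \<in> C"
proof -
  define S where "S = closure (convex hull (range x))"
  define \<F> where "\<F> = {C. closed C \<and> convex C \<and> eventually (\<lambda>n. x n \<in> C) sequentially}"
  have xS: "x n \<in> S" for n
    unfolding S_def by (meson closure_subset hull_subset rangeI subsetD)
  have "\<Inter>\<F> \<noteq> {}"
  proof (rule reflexive_closed_convex_fip[OF refl])
    show "S \<in> \<F>" using xS by (auto simp: \<F>_def S_def)
    show "bounded S" unfolding S_def using x by (simp add: bounded_closure bounded_convex_hull)
    show "\<And>C. C \<in> \<F> \<Longrightarrow> closed C \<and> convex C" by (auto simp: \<F>_def)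
    fix \<G> assume G: "finite \<G>" "\<G> \<subseteq> \<F>"
    have "eventually (\<lambda>n. \<forall>C\<in>\<G>. x n \<in> C) sequentially"
      using G by (intro eventually_ball_finite) (auto simp: \<F>_def)
    then obtain n where "\<forall>C\<in>\<G>. x n \<in> C" by (auto simp: eventually_sequentially)
    then show "S \<inter> \<Inter>\<G> \<noteq> {}" using xS by blast
  qed
  then obtain z where "z \<in> \<Inter>\<F>" by blast
  then show ?thesis by (intro exI[of _ z]) (auto simp: \<F>_def)
qed

text \<open>Recursion on the number of points, in place of a sum over coefficient lists, turns countability
  and closure under addition into short inductions.\<close>

primrec rational_combinations :: "(nat \<Rightarrow> 'a::real_vector) \<Rightarrow> nat \<Rightarrow> 'a set" where
  "rational_combinations x 0 = {0}"
| "rational_combinations x (Suc n) =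
     (\<lambda>(y, q). y + real_of_rat q *\<^sub>R x n) ` (rational_combinations x n \<times> UNIV)"

lemma countable_rational_combinations: "countable (rational_combinations x n)"
  by (induction n) auto

lemma rational_combinations_Suc_mono:
  "rational_combinations x n \<subseteq> rational_combinations x (Suc n)"
proof
  fix y assume "y \<in> rational_combinations x n"
  then show "y \<in> rational_combinations x (Suc n)" by (force intro: image_eqI[of _ _ "(y, 0)"])
qed

lemma rational_combinations_mono:
  "m \<le> n \<Longrightarrow> rational_combinations x m \<subseteq> rational_combinations x n"
  by (rule lift_Suc_mono_le[of "rational_combinations x"]) (rule rational_combinations_Suc_mono)

lemma rational_combinations_add:
  "y \<in> rational_combinations x n \<Longrightarrow> z \<in> rational_combinations x n \<Longrightarrow>
   y + z \<in> rational_combinations x n"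
proof (induction n arbitrary: y z)
  case (Suc n)
  obtain u q where y: "y = u + real_of_rat q *\<^sub>R x n" "u \<in> rational_combinations x n"
    using Suc.prems(1) by auto
  obtain v r where z: "z = v + real_of_rat r *\<^sub>R x n" "v \<in> rational_combinations x n"
    using Suc.prems(2) by auto
  have "y + z = (u + v) + real_of_rat (q + r) *\<^sub>R x n"
    by (simp add: y z of_rat_add algebra_simps)
  then show ?case using Suc.IH[OF y(2) z(2)] by force
qed simp

lemma rational_combinations_scale:
  "y \<in> rational_combinations x n \<Longrightarrow> real_of_rat r *\<^sub>R y \<in> rational_combinations x n"
proof (induction n arbitrary: y)
  case (Suc n)
  obtain u q where y: "y = u + real_of_rat q *\<^sub>R x n" "u \<in> rational_combinations x n"
    using Suc.prems(1) by auto
  have "real_of_rat r *\<^sub>R y = real_of_rat r *\<^sub>R u + real_of_rat (r * q) *\<^sub>R x n"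
    by (simp add: y of_rat_mult algebra_simps)
  then show ?case using Suc.IH[OF y(2)] by force
qed simp

lemma countable_dense_in_subspace:
  fixes x :: "nat \<Rightarrow> 'a::real_normed_vector"
  shows "\<exists>D. countable D \<and> range x \<subseteq> closure D \<and> subspace (closure D)"
proof -
  define D where "D = (\<Union>n. rational_combinations x n)"
  have D0: "0 \<in> D" unfolding D_def by (rule UN_I[of 0]) auto
  have Dadd: "y + z \<in> D" if yz: "y \<in> D" "z \<in> D" for y z
  proof -
    obtain m n where "y \<in> rational_combinations x m" "z \<in> rational_combinations x n"
      using yz by (auto simp: D_def)
    then have "y \<in> rational_combinations x (max m n)" "z \<in> rational_combinations x (max m n)"
      using rational_combinations_mono[of m "max m n" x] rational_combinations_mono[of n "max m n" x]
      by auto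
    then show ?thesis unfolding D_def using rational_combinations_add by blast
  qed
  have Dscale: "real_of_rat q *\<^sub>R y \<in> D" if "y \<in> D" for q y
    using that rational_combinations_scale unfolding D_def by blast
  have Dreal: "r *\<^sub>R y \<in> closure D" if "y \<in> D" for r y
  proof -
    have "continuous_on UNIV (\<lambda>r. r *\<^sub>R y)" by (intro continuous_intros)
    then have "(\<lambda>r. r *\<^sub>R y) ` closure \<rat> \<subseteq> closure ((\<lambda>r. r *\<^sub>R y) ` \<rat>)"
      by (intro image_closure_subset closure_subset closed_closure) (auto intro: continuous_on_subset)
    also have "\<dots> \<subseteq> closure D"
      using Dscale[OF that] by (intro closure_mono) (auto simp: Rats_def)
    finally show ?thesis by (auto simp: Rats_closure_real)
  qed
  have "subspace (closure D)"
    unfolding subspace_def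
  proof (intro conjI ballI allI)
    show "0 \<in> closure D" using D0 closure_subset by blast
  next
    fix y z assume "y \<in> closure D" "z \<in> closure D"
    then obtain u v where "\<forall>n::nat. u n \<in> D" "u \<longlonglongrightarrow> y" "\<forall>n. v n \<in> D" "v \<longlonglongrightarrow> z"
      unfolding closure_sequential by blast
    then show "y + z \<in> closure D"
      unfolding closure_sequential using Dadd
      by (intro exI[of _ "\<lambda>n. u n + v n"]) (auto intro: tendsto_add)
  next
    fix r y assume "y \<in> closure D"
    then obtain u where u: "\<forall>n::nat. u n \<in> D" "u \<longlonglongrightarrow> y"
      unfolding closure_sequential by blast
    then show "r *\<^sub>R y \<in> closure D"
      using closed_sequentially[OF closed_closure, of "\<lambda>n. r *\<^sub>R u n" D] Dreal
        tendsto_scaleR[OF tendsto_const[of r] u(2)] by blast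
  qed
  moreover have "x n \<in> D" for n
  proof -
    have "0 \<in> rational_combinations x n"
      using rational_combinations_mono[of 0 n x] by auto
    then have "x n \<in> rational_combinations x (Suc n)"
      by (force intro: image_eqI[of _ _ "(0, 1)"])
    then show ?thesis unfolding D_def by blast
  qed
  moreover have "countable D" unfolding D_def by (simp add: countable_rational_combinations)
  ultimately show ?thesis using closure_subset by (intro exI[of _ D]) auto
qed

text \<open>The sequential half of the Eberlein--Smulian theorem. The closed linear span of the sequence
  has a countable dense subset, and norming functionals of its elements separate the points of the
  span. Along a subsequence on which these countably many functionals converge, any two weak cluster
  points agree; since each further subsequence has a cluster point, the subsequence converges.\<close>

theorem reflexive_weakly_convergent_subsequence:
  fixes x :: "nat \<Rightarrow> 'a::real_normed_vector"
  assumes refl: "reflexive_space TYPE('a)" and x: "bounded (range x)"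
  shows "\<exists>r z. strict_mono r \<and> weakly_converges (x \<circ> r) z"
proof -
  obtain D where D: "countable D" "range x \<subseteq> closure D" "subspace (closure D)"
    using countable_dense_in_subspace[of x] by blast
  define F :: "'a \<Rightarrow> 'a \<Rightarrow>\<^sub>L real"
    where "F y = (SOME f. norm f \<le> 1 \<and> blinfun_apply f y = norm y)" for y
  have F: "norm (F y) \<le> 1" "blinfun_apply (F y) y = norm y" for y
    using someI_ex[OF exists_norming_functional[of y]] unfolding F_def by auto
  have Fle: "\<bar>blinfun_apply (F y) v\<bar> \<le> norm v" for y v
  proof -
    have "\<bar>blinfun_apply (F y) v\<bar> \<le> norm (F y) * norm v" using norm_blinfun[of "F y" v] by simp
    also have "\<dots> \<le> norm v" using F(1) by (simp add: mult_left_le_one_le)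
    finally show ?thesis .
  qed
  have separating: "w = 0" if w: "w \<in> closure D" "\<And>y. y \<in> D \<Longrightarrow> blinfun_apply (F y) w = 0" for w
  proof (rule ccontr)
    assume "w \<noteq> 0"
    then obtain y where y: "y \<in> D" "dist y w < norm w / 2"
      using w(1) unfolding closure_approachable by (metis half_gt_zero zero_less_norm_iff)
    have "norm y = blinfun_apply (F y) (y - w)"
      using F(2) w(2)[OF y(1)] by (simp add: blinfun.diff_right)
    also have "\<dots> \<le> norm (y - w)" using Fle[of y "y - w"] by simp
    finally have "norm y \<le> norm (y - w)" .
    moreover have "norm w \<le> norm y + norm (y - w)" using norm_triangle_ineq4[of y "y - w"] by simp
    ultimately show False using y(2) by (simp add: dist_norm)
  qed
  obtain M where M: "\<And>n. norm (x n) \<le> M" using x by (auto simp: bounded_iff)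
  obtain r :: "nat \<Rightarrow> nat" where r: "strict_mono r"
    and conv: "\<And>y. y \<in> D \<Longrightarrow> \<exists>l. (\<lambda>n. blinfun_apply (F y) (x (r n))) \<longlonglongrightarrow> l"
  proof (rule function_convergent_subsequence[OF D(1), of "\<lambda>n y. blinfun_apply (F y) (x n)" M])
    show "norm (blinfun_apply (F y) (x n)) \<le> M" for n y
      using Fle[of y "x n"] M[of n] by simp
  qed blast
  have bdd: "bounded (range (x \<circ> s))" for s :: "nat \<Rightarrow> nat" using M by (auto simp: bounded_iff)
  have halfspace: "closed {v. a \<le> blinfun_apply f v}" "convex {v. a \<le> blinfun_apply f v}"
    "closed {v. blinfun_apply f v \<le> a}" "convex {v. blinfun_apply f v \<le> a}"
    for a and f :: "'a \<Rightarrow>\<^sub>L real"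
  proof -
    show "closed {v. a \<le> blinfun_apply f v}" "closed {v. blinfun_apply f v \<le> a}"
      by (intro closed_Collect_le continuous_intros)+
    have eq: "{v. a \<le> blinfun_apply f v} = blinfun_apply f -` {a..}"
      "{v. blinfun_apply f v \<le> a} = blinfun_apply f -` {..a}" by auto
    show "convex {v. a \<le> blinfun_apply f v}" "convex {v. blinfun_apply f v \<le> a}"
      unfolding eq by (intro convex_linear_vimage bounded_linear.linear blinfun.bounded_linear_right; simp)+
  qed
  define cluster where "cluster s z \<longleftrightarrow> (\<forall>C. closed C \<longrightarrow> convex C \<longrightarrow>
      eventually (\<lambda>n. x (s n) \<in> C) sequentially \<longrightarrow> z \<in> C)" for s :: "nat \<Rightarrow> nat" and z
  have ex_cluster: "\<exists>z. cluster s z" for s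
    unfolding cluster_def using reflexive_common_point_of_tails[OF refl bdd[of s]] by simp
  have clusterD: "z \<in> C"
    if "cluster s z" "closed C" "convex C" "eventually (\<lambda>n. x (s n) \<in> C) sequentially" for s z C
    using that by (simp add: cluster_def)
  have cluster_lim: "blinfun_apply f z = l"
    if z: "cluster s z" and l: "(\<lambda>n. blinfun_apply f (x (s n))) \<longlonglongrightarrow> l" for s z l
      and f :: "'a \<Rightarrow>\<^sub>L real"
  proof (rule antisym)
    have approx: "blinfun_apply f z \<le> l + e" "l - e \<le> blinfun_apply f z" if "e > 0" for e
    proof -
      have up: "eventually (\<lambda>n. x (s n) \<in> {v. blinfun_apply f v \<le> l + e}) sequentially"
        using order_tendstoD(2)[OF l, of "l + e"] that by (auto elim!: eventually_mono)
      have low: "eventually (\<lambda>n. x (s n) \<in> {v. l - e \<le> blinfun_apply f v}) sequentially"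
        using order_tendstoD(1)[OF l, of "l - e"] that by (auto elim!: eventually_mono)
      show "blinfun_apply f z \<le> l + e" "l - e \<le> blinfun_apply f z"
        using clusterD[OF z halfspace(3,4) up] clusterD[OF z halfspace(1,2) low] by auto
    qed
    show "blinfun_apply f z \<le> l" by (rule field_le_epsilon) (rule approx)
    show "l \<le> blinfun_apply f z" by (rule field_le_epsilon) (use approx in \<open>simp add: diff_le_eq\<close>)
  qed
  have cluster_closure: "z \<in> closure D" if z: "cluster s z" for s z
  proof -
    have "eventually (\<lambda>n. x (s n) \<in> closure D) sequentially"
      using D(2) by (intro always_eventually) auto
    then show ?thesis
      by (rule clusterD[OF z closed_closure subspace_imp_convex[OF D(3)]])
  qed
  obtain z where z: "cluster r z" using ex_cluster by blast
  have unique: "z' = z" if s: "strict_mono s" and z': "cluster (r \<circ> s) z'" for s :: "nat \<Rightarrow> nat" and z'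
  proof -
    have "blinfun_apply (F y) (z' - z) = 0" if "y \<in> D" for y
    proof -
      obtain l where l: "(\<lambda>n. blinfun_apply (F y) (x (r n))) \<longlonglongrightarrow> l" using conv[OF \<open>y \<in> D\<close>] by blast
      then have "(\<lambda>n. blinfun_apply (F y) (x ((r \<circ> s) n))) \<longlonglongrightarrow> l"
        using LIMSEQ_subseq_LIMSEQ[OF l s] by (simp add: comp_def)
      then show ?thesis
        using cluster_lim[OF z l] cluster_lim[OF z'] by (simp add: blinfun.diff_right)
    qed
    moreover have "z' - z \<in> closure D"
      using cluster_closure[OF z] cluster_closure[OF z'] D(3) by (intro subspace_diff)
    ultimately have "z' - z = 0" by (rule separating[rotated])
    then show ?thesis by simp
  qed
  have "weakly_converges (x \<circ> r) z"
    unfolding weakly_converges_def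
  proof (intro allI)
    fix f :: "'a \<Rightarrow>\<^sub>L real"
    show "(\<lambda>n. blinfun_apply f ((x \<circ> r) n)) \<longlonglongrightarrow> blinfun_apply f z"
    proof (rule ccontr)
      assume "\<not> ?thesis"
      then obtain e where e: "e > 0"
        and "\<not> eventually (\<lambda>n. \<bar>blinfun_apply f (x (r n)) - blinfun_apply f z\<bar> < e) sequentially"
        by (auto simp: tendsto_iff dist_real_def)
      then have freq: "\<exists>\<^sub>\<infinity>n. e \<le> \<bar>blinfun_apply f (x (r n)) - blinfun_apply f z\<bar>"
        by (simp add: cofinite_eq_sequentially frequently_def not_le)
      then obtain s :: "nat \<Rightarrow> nat" where s: "strict_mono s"
        and far: "\<And>n. e \<le> \<bar>blinfun_apply f (x (r (s n))) - blinfun_apply f z\<bar>"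
        using infinite_enumerate[of "{n. e \<le> \<bar>blinfun_apply f (x (r n)) - blinfun_apply f z\<bar>}"]
        by (auto simp: frequently_cofinite)
      \<comment> \<open>On a further subsequence the real numbers \<open>f (x (r (s n)))\<close> converge.\<close>
      have "bounded (range (\<lambda>n. blinfun_apply f (x (r (s n)))))"
        using bounded_linear_image[OF bdd[of "r \<circ> s"] blinfun.bounded_linear_right[of f]]
        by (simp add: image_image comp_def)
      then obtain l t where t: "strict_mono t" and lim: "((\<lambda>n. blinfun_apply f (x (r (s n)))) \<circ> t) \<longlonglongrightarrow> l"
        using bounded_imp_convergent_subsequence by blast
      obtain z' where z': "cluster (r \<circ> (s \<circ> t)) z'" using ex_cluster by blast
      have "z' = z" using unique[OF strict_mono_o[OF s t] z'] .
      moreover have "blinfun_apply f z' = l" using cluster_lim[OF z'] lim by (simp add: comp_def)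
      ultimately have "(\<lambda>n. blinfun_apply f (x (r (s (t n))))) \<longlonglongrightarrow> blinfun_apply f z"
        using lim by (simp add: comp_def)
      then have "eventually (\<lambda>n. \<bar>blinfun_apply f (x (r (s (t n)))) - blinfun_apply f z\<bar> < e) sequentially"
        using e by (auto simp: tendsto_iff dist_real_def)
      then obtain n where "\<bar>blinfun_apply f (x (r (s (t n)))) - blinfun_apply f z\<bar> < e"
        unfolding eventually_sequentially by blast
      with far[of "t n"] show False by simp
    qed
  qed
  then show ?thesis using r by blast
qed

section \<open>Separated sequences\<close>

text \<open>The normalisation in the definition of the UKK property is removed by scaling; the bound
  \<open>R\<^sub>0\<close> on the radii keeps the relative separation away from \<open>0\<close>, which makes \<open>\<delta>\<close> uniform.\<close>

lemma UKK_weak_limit_norm_drop: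
  assumes ukk: "UKK_norm TYPE('a::real_normed_vector)" and pos: "0 < \<epsilon>" "0 < R\<^sub>0"
  shows "\<exists>\<delta>. 0 < \<delta> \<and> \<delta> < 1 \<and>
    (\<forall>(x :: nat \<Rightarrow> 'a) z R. 0 < R \<longrightarrow> R \<le> R\<^sub>0 \<longrightarrow> (\<forall>n. norm (x n) \<le> R) \<longrightarrow>
      weakly_converges x z \<longrightarrow> (\<forall>m n. m \<noteq> n \<longrightarrow> \<epsilon> \<le> norm (x m - x n)) \<longrightarrow>
      norm z \<le> (1 - \<delta>) * R)"
proof -
  have "0 < \<epsilon> / (2 * R\<^sub>0)" using pos by simp
  then obtain \<delta> where \<delta>: "\<delta> > 0" and drop: "\<And>(y :: nat \<Rightarrow> 'a) y0. range y \<subseteq> cball 0 1 \<Longrightarrow>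
      weakly_converges y y0 \<Longrightarrow> \<epsilon> / (2 * R\<^sub>0) < Inf {norm (y n - y m) |n m. n \<noteq> m} \<Longrightarrow> norm y0 \<le> 1 - \<delta>"
    using ukk unfolding UKK_norm_def by blast
  have "norm z \<le> (1 - min \<delta> (1/2)) * R"
    if R: "0 < R" "R \<le> R\<^sub>0" and xR: "\<forall>n. norm (x n) \<le> R" and w: "weakly_converges x z"
      and sep: "\<forall>m n. m \<noteq> n \<longrightarrow> \<epsilon> \<le> norm (x m - x n)" for x :: "nat \<Rightarrow> 'a" and z R
  proof -
    define y where "y n = inverse R *\<^sub>R x n" for n
    have "range y \<subseteq> cball 0 1" using xR R by (auto simp: y_def field_simps)
    moreover have "weakly_converges y (inverse R *\<^sub>R z)"
      using w unfolding weakly_converges_def y_def by (auto simp: blinfun.scaleR_right intro: tendsto_intros)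
    moreover have "\<epsilon> / (2 * R\<^sub>0) < Inf {norm (y n - y m) |n m. n \<noteq> m}"
    proof -
      have "\<epsilon> / R \<le> norm (y n - y m)" if "n \<noteq> m" for n m
      proof -
        have "norm (y n - y m) = norm (x n - x m) / R"
          unfolding y_def scaleR_diff_right[symmetric] using R by (simp add: divide_inverse mult.commute)
        then show ?thesis using sep that R by (simp add: divide_right_mono)
      qed
      then have "\<epsilon> / R \<le> Inf {norm (y n - y m) |n m. n \<noteq> m}"
        by (intro cInf_greatest) (auto intro: exI[of _ "0::nat"] exI[of _ "1::nat"])
      moreover have "\<epsilon> / (2 * R\<^sub>0) < \<epsilon> / R" using R pos by (intro divide_strict_left_mono) auto
      ultimately show ?thesis by linarith
    qed
    ultimately have "norm (inverse R *\<^sub>R z) \<le> 1 - \<delta>" by (rule drop)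
    then have "norm z \<le> (1 - \<delta>) * R" using R by (simp add: field_simps)
    also have "\<dots> \<le> (1 - min \<delta> (1/2)) * R" using R by (intro mult_right_mono) auto
    finally show ?thesis .
  qed
  then show ?thesis using \<delta> by (intro exI[of _ "min \<delta> (1/2)"]) auto
qed

text \<open>A range without a finite \<open>e\<close>-net lets one choose greedily an \<open>e\<close>-separated subsequence; if
  there is a finite net for every \<open>e\<close>, then the closure of the range is compact.\<close>

lemma convergent_subsequence_if_no_separated:
  fixes c :: "nat \<Rightarrow> 'a::complete_space"
  assumes nosep: "\<And>(r :: nat \<Rightarrow> nat) e. strict_mono r \<Longrightarrow> 0 < e \<Longrightarrow> \<exists>m n. m \<noteq> n \<and> dist (c (r m)) (c (r n)) < e"
  shows "\<exists>s l. strict_mono s \<and> (c \<circ> s) \<longlonglongrightarrow> l"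
proof -
  have cover: "\<exists>N. range c \<subseteq> (\<Union>i\<le>N. ball (c i) e)" if e: "0 < e" for e
  proof (rule ccontr)
    assume no: "\<nexists>N. range c \<subseteq> (\<Union>i\<le>N. ball (c i) e)"
    define P where "P r n k \<longleftrightarrow> (\<forall>m<n. r m < k \<and> e \<le> dist (c (r m)) (c k))"
      for r :: "nat \<Rightarrow> nat" and n k :: nat
    have "\<exists>r. \<forall>n. P r n (r n)"
    proof (rule dependent_wellorder_choice)
      show "P r n k = P r' n k" if "\<And>m. m < n \<Longrightarrow> r m = r' m" for k r r' n
        using that by (auto simp: P_def)
      show "\<exists>k. P r n k" for n r
      proof -
        define N where "N = Max (insert 0 (r ` {..<n}))"
        have N: "r m \<le> N" if "m < n" for m unfolding N_def using that by (intro Max_ge) auto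
        obtain k where k: "c k \<notin> (\<Union>i\<le>N. ball (c i) e)" using no by blast
        have "N < k"
        proof (rule ccontr)
          assume "\<not> N < k"
          then have "c k \<in> (\<Union>i\<le>N. ball (c i) e)" using e by (intro UN_I[of k]) auto
          with k show False by blast
        qed
        moreover have "e \<le> dist (c (r m)) (c k)" if "m < n" for m
          using k N[OF that] by force
        ultimately have "P r n k" using N by (force simp: P_def)
        then show ?thesis by blast
      qed
    qed
    then obtain r where "\<forall>n. P r n (r n)" ..
    then have r: "\<And>m n. m < n \<Longrightarrow> r m < r n" "\<And>m n. m < n \<Longrightarrow> e \<le> dist (c (r m)) (c (r n))"
      by (simp_all add: P_def)
    have "e \<le> dist (c (r m)) (c (r n))" if "m \<noteq> n" for m n
      using r(2)[of m n] r(2)[of n m] that by (cases "m < n") (auto simp: dist_commute)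
    moreover have "strict_mono r" using r(1) by (auto simp: strict_mono_def)
    moreover obtain m n where "m \<noteq> n" "dist (c (r m)) (c (r n)) < e"
      using nosep[OF \<open>strict_mono r\<close> e] by blast
    ultimately show False by (meson not_less)
  qed
  have "compact (closure (range c))"
    unfolding compact_eq_totally_bounded
  proof (intro conjI allI impI)
    show "complete (closure (range c))" by (simp add: complete_eq_closed)
    fix e :: real assume e: "0 < e"
    then obtain N where N: "range c \<subseteq> (\<Union>i\<le>N. ball (c i) (e/2))" using cover[of "e/2"] by auto
    have "closure (range c) \<subseteq> (\<Union>i\<le>N. cball (c i) (e/2))"
    proof (rule closure_minimal)
      have "(\<Union>i\<le>N. ball (c i) (e/2)) \<subseteq> (\<Union>i\<le>N. cball (c i) (e/2))"
        by (intro UN_mono ball_subset_cball order_refl)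
      with N show "range c \<subseteq> (\<Union>i\<le>N. cball (c i) (e/2))" by (rule order_trans)
    qed auto
    also have "\<dots> \<subseteq> (\<Union>i\<le>N. ball (c i) e)"
      by (intro UN_mono order_refl subsetI) (use e in simp)
    also have "\<dots> = (\<Union>x\<in>c ` {..N}. ball x e)" by simp
    finally show "\<exists>k. finite k \<and> closure (range c) \<subseteq> (\<Union>x\<in>k. ball x e)"
      by (intro exI[of _ "c ` {..N}"]) auto
  qed
  then have "seq_compact (closure (range c))" by (simp add: compact_eq_seq_compact_metric)
  moreover have "\<forall>n. c n \<in> closure (range c)" using closure_subset[of "range c"] by auto
  ultimately obtain l s where "strict_mono s" "(c \<circ> s) \<longlonglongrightarrow> l" by (rule seq_compactE)
  then show ?thesis by blast
qed

section \<open>Asymptotic sublevel sets\<close>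

text \<open>The points at which the asymptotic radius functional, the limit superior of
  \<open>norm (u n - v)\<close>, is at most \<open>t\<close>; the quantifier over \<open>s\<close> avoids extended real values.\<close>

definition asymptotic_sublevel :: "(nat \<Rightarrow> 'a::real_normed_vector) \<Rightarrow> real \<Rightarrow> 'a set" where
  "asymptotic_sublevel u t = {v. \<forall>s>t. eventually (\<lambda>n. norm (u n - v) \<le> s) sequentially}"

lemma asymptotic_sublevelD:
  "v \<in> asymptotic_sublevel u t \<Longrightarrow> t < s \<Longrightarrow> eventually (\<lambda>n. norm (u n - v) \<le> s) sequentially"
  by (auto simp: asymptotic_sublevel_def)

lemma asymptotic_sublevelI:
  "eventually (\<lambda>n. norm (u n - v) \<le> t) sequentially \<Longrightarrow> v \<in> asymptotic_sublevel u t"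
  by (auto simp: asymptotic_sublevel_def elim: eventually_mono)

lemma asymptotic_sublevel_mono: "t \<le> t' \<Longrightarrow> asymptotic_sublevel u t \<subseteq> asymptotic_sublevel u t'"
  by (auto simp: asymptotic_sublevel_def)

lemma asymptotic_sublevel_right_continuous:
  assumes "\<And>s. t < s \<Longrightarrow> v \<in> asymptotic_sublevel u s"
  shows "v \<in> asymptotic_sublevel u t"
  unfolding asymptotic_sublevel_def
proof (intro CollectI allI impI)
  fix s assume "t < s"
  then show "eventually (\<lambda>n. norm (u n - v) \<le> s) sequentially"
    using asymptotic_sublevelD[OF assms[of "(s + t) / 2"], of s] by (simp add: field_simps)
qed

lemma asymptotic_sublevel_nonneg:
  assumes "v \<in> asymptotic_sublevel u t"
  shows "0 \<le> t"
proof (rule ccontr)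
  assume "\<not> 0 \<le> t"
  then have "eventually (\<lambda>n. norm (u n - v) \<le> t / 2) sequentially"
    by (intro asymptotic_sublevelD[OF assms]) auto
  then obtain n where "norm (u n - v) \<le> t / 2" by (auto simp: eventually_sequentially)
  then show False using \<open>\<not> 0 \<le> t\<close> norm_ge_zero[of "u n - v"] by linarith
qed

lemma closed_asymptotic_sublevel: "closed (asymptotic_sublevel u t)"
proof -
  have "v \<in> asymptotic_sublevel u t" if v: "v \<in> closure (asymptotic_sublevel u t)" for v
    unfolding asymptotic_sublevel_def
  proof (intro CollectI allI impI)
    fix s assume s: "t < s"
    then obtain y where y: "y \<in> asymptotic_sublevel u t" "dist y v < (s - t) / 2"
      using v unfolding closure_approachable by (metis diff_gt_0_iff_gt half_gt_zero)
    have "eventually (\<lambda>n. norm (u n - y) \<le> (s + t) / 2) sequentially"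
      using s by (intro asymptotic_sublevelD[OF y(1)]) auto
    then show "eventually (\<lambda>n. norm (u n - v) \<le> s) sequentially"
    proof eventually_elim
      case (elim n)
      have "norm (u n - v) \<le> norm (u n - y) + norm (y - v)"
        using norm_triangle_ineq[of "u n - y" "y - v"] by simp
      then show ?case using elim y(2) by (simp add: dist_norm field_simps)
    qed
  qed
  then show ?thesis by (metis closure_subset_eq subsetI)
qed

lemma convex_asymptotic_sublevel: "convex (asymptotic_sublevel u t)"
proof (rule convexI)
  fix x y and a b :: real
  assume x: "x \<in> asymptotic_sublevel u t" and y: "y \<in> asymptotic_sublevel u t"
    and ab: "0 \<le> a" "0 \<le> b" "a + b = 1"
  show "a *\<^sub>R x + b *\<^sub>R y \<in> asymptotic_sublevel u t"
    unfolding asymptotic_sublevel_def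
  proof (intro CollectI allI impI)
    fix s assume s: "t < s"
    show "eventually (\<lambda>n. norm (u n - (a *\<^sub>R x + b *\<^sub>R y)) \<le> s) sequentially"
      using asymptotic_sublevelD[OF x s] asymptotic_sublevelD[OF y s]
    proof eventually_elim
      case (elim n)
      have "u n = a *\<^sub>R u n + b *\<^sub>R u n" using ab(3) by (metis scaleR_add_left scaleR_one)
      then have "u n - (a *\<^sub>R x + b *\<^sub>R y) = a *\<^sub>R (u n - x) + b *\<^sub>R (u n - y)"
        by (simp add: algebra_simps)
      then have "norm (u n - (a *\<^sub>R x + b *\<^sub>R y)) \<le> a * norm (u n - x) + b * norm (u n - y)"
        using norm_triangle_ineq[of "a *\<^sub>R (u n - x)" "b *\<^sub>R (u n - y)"] ab by simp
      also have "\<dots> \<le> s" using elim ab by (intro convex_bound_le) auto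
      finally show ?case .
    qed
  qed
qed

section \<open>Minimal orbit-stable sets\<close>

text \<open>The function \<open>(x, y) \<mapsto> norm (x - h - y)\<close> plays the role of a metric on \<open>A\<close> whose value on the
  diagonal is \<open>norm h\<close> instead of \<open>0\<close>. Up to the error \<open>e\<close>, the inequality \<open>shift\<close> is what the
  iterates \<open>c n\<close> of an asymptotically nonexpansive map would satisfy. It stands in place of the
  semigroup law, which is lost when the odd iterates of a cyclic map are moved back to \<open>A\<close>.\<close>

locale asymptotic_orbits =
  fixes A :: "'a::banach set" and c :: "nat \<Rightarrow> 'a \<Rightarrow> 'a" and h :: 'a
    and k :: "nat \<Rightarrow> real" and e :: "nat \<Rightarrow> 'a \<Rightarrow> real"
  assumes nuc: "NUC_space TYPE('a)"
    and A: "A \<noteq> {}" "bounded A" "closed A" "convex A"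
    and c_in: "x \<in> A \<Longrightarrow> c n x \<in> A"
    and gap_sym: "x \<in> A \<Longrightarrow> y \<in> A \<Longrightarrow> norm (x - h - y) = norm (y - h - x)"
    and shift: "x \<in> A \<Longrightarrow> y \<in> A \<Longrightarrow>
        norm (c (m + j) x - h - c m y) \<le> k m * norm (c j x - h - y) + e m y"
    and k_nonneg: "0 \<le> k m" and k_lim: "k \<longlonglongrightarrow> 1"
    and e_lim: "y \<in> A \<Longrightarrow> (\<lambda>m. e m y) \<longlonglongrightarrow> 0"
begin

lemma reflexive: "reflexive_space TYPE('a)" and ukk: "UKK_norm TYPE('a)"
  using nuc by (auto simp: NUC_space_def)

text \<open>The orbits themselves may leave \<open>K\<close>. Only their weak limits are controlled, since this is the
  property that passes to the sublevel sets of the asymptotic gap to a given orbit.\<close>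

definition orbit_stable :: "'a set \<Rightarrow> bool" where
  "orbit_stable K \<longleftrightarrow> K \<noteq> {} \<and> K \<subseteq> A \<and> closed K \<and> convex K \<and>
     (\<forall>x\<in>K. \<forall>r z. strict_mono r \<longrightarrow> weakly_converges (\<lambda>i. c (r i) x) z \<longrightarrow> z \<in> K)"

definition minimal_stable :: "'a set \<Rightarrow> bool" where
  "minimal_stable K \<longleftrightarrow> orbit_stable K \<and> (\<forall>K'. orbit_stable K' \<longrightarrow> K' \<subseteq> K \<longrightarrow> K' = K)"

lemma orbit_stable_A: "orbit_stable A"
  unfolding orbit_stable_def
proof (intro conjI A order_refl ballI allI impI)
  fix x r z assume "x \<in> A" "weakly_converges (\<lambda>i. c (r i) x) z"
  then show "z \<in> A"
    using c_in by (intro weak_limit_in_closed_convex[OF _ A(4,3)]) auto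
qed

text \<open>In Zorn's lemma the intersection of a chain is nonempty by weak compactness.\<close>

lemma exists_minimal_stable: "\<exists>K. minimal_stable K"
proof -
  let ?Q = "Collect orbit_stable"
  let ?R = "relation_of (\<lambda>K K'. K' \<subseteq> K) ?Q"
  have po: "partial_order_on ?Q ?R"
    by (rule partial_order_on_relation_ofI) auto
  have "\<exists>m\<in>?Q. \<forall>a\<in>?Q. a \<subseteq> m \<longrightarrow> a = m"
  proof (rule predicate_Zorn[OF po])
    fix \<C> assume C: "\<C> \<in> Chains ?R"
    show "\<exists>u\<in>?Q. \<forall>a\<in>\<C>. u \<subseteq> a"
    proof (cases "\<C> = {}")
      case True
      then show ?thesis using orbit_stable_A by blast
    next
      case False
      then obtain K0 where K0: "K0 \<in> \<C>" by blast
      have stable: "orbit_stable K" if "K \<in> \<C>" for K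
        using that C by (auto simp: Chains_def relation_of_def)
      have chain: "K \<subseteq> K' \<or> K' \<subseteq> K" if "K \<in> \<C>" "K' \<in> \<C>" for K K'
        using that C by (auto simp: Chains_def relation_of_def)
      have lower: "\<exists>K\<in>\<C>. K \<subseteq> K0 \<inter> \<Inter>\<G>" if "finite \<G>" "\<G> \<subseteq> \<C>" for \<G>
        using that
      proof (induction \<G>)
        case empty
        then show ?case using K0 by auto
      next
        case (insert L \<G>)
        then obtain K where K: "K \<in> \<C>" "K \<subseteq> K0 \<inter> \<Inter>\<G>" by auto
        have "L \<in> \<C>" using insert.prems by simp
        from chain[OF K(1) this] show ?case
        proof
          assume "K \<subseteq> L"
          then show ?thesis using K by (intro bexI[of _ K]) auto
        next
          assume "L \<subseteq> K"
          then show ?thesis using K \<open>L \<in> \<C>\<close> by (intro bexI[of _ L]) auto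
        qed
      qed
      have "\<Inter>\<C> \<noteq> {}"
      proof (rule reflexive_closed_convex_fip[OF reflexive K0])
        show "bounded K0" using stable[OF K0] A(2) bounded_subset by (auto simp: orbit_stable_def)
        show "\<And>K. K \<in> \<C> \<Longrightarrow> closed K \<and> convex K" using stable by (auto simp: orbit_stable_def)
        fix \<G> assume G: "finite \<G>" "\<G> \<subseteq> \<C>"
        obtain K where "K \<in> \<C>" "K \<subseteq> K0 \<inter> \<Inter>\<G>" using lower[OF G] by blast
        moreover have "K \<noteq> {}" using stable[OF \<open>K \<in> \<C>\<close>] by (simp add: orbit_stable_def)
        ultimately show "K0 \<inter> \<Inter>\<G> \<noteq> {}" by blast
      qed
      moreover have "\<Inter>\<C> \<subseteq> A" using K0 stable by (fastforce simp: orbit_stable_def)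
      moreover have "closed (\<Inter>\<C>)" "convex (\<Inter>\<C>)"
        using stable by (auto simp: orbit_stable_def intro: convex_Inter)
      moreover have "z \<in> \<Inter>\<C>"
        if "x \<in> \<Inter>\<C>" "strict_mono r" "weakly_converges (\<lambda>i. c (r i) x) z" for x r z
        using that stable unfolding orbit_stable_def by blast
      ultimately have "orbit_stable (\<Inter>\<C>)" unfolding orbit_stable_def by blast
      then show ?thesis by blast
    qed
  qed
  then show ?thesis unfolding minimal_stable_def by blast
qed

abbreviation near :: "'a \<Rightarrow> real \<Rightarrow> 'a set" where
  "near x t \<equiv> asymptotic_sublevel (\<lambda>n. c n x - h) t"

text \<open>If \<open>y\<close> is asymptotically within \<open>t\<close> of the orbit of \<open>x\<close>, then \<open>shift\<close> places the points
  \<open>c m y\<close> asymptotically within any \<open>s > t\<close>, once \<open>m\<close> is large; weak limits inherit this because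
  sublevel sets are closed and convex.\<close>

lemma orbit_stable_Int_near:
  assumes K: "orbit_stable K" and x: "x \<in> A" and ne: "K \<inter> near x t \<noteq> {}"
  shows "orbit_stable (K \<inter> near x t)"
proof -
  have "z \<in> near x t"
    if y: "y \<in> K" "y \<in> near x t" and r: "strict_mono r" and w: "weakly_converges (\<lambda>i. c (r i) y) z"
    for y r z
  proof (rule asymptotic_sublevel_right_continuous)
    fix s assume s: "t < s"
    have yA: "y \<in> A" using y(1) K by (auto simp: orbit_stable_def)
    have "(\<lambda>m. k m * ((s + t) / 2) + e m y) \<longlonglongrightarrow> 1 * ((s + t) / 2) + 0"
      by (intro tendsto_intros k_lim e_lim yA)
    moreover have "1 * ((s + t) / 2) + 0 < s" using s by simp
    ultimately have "eventually (\<lambda>m. k m * ((s + t) / 2) + e m y < s) sequentially"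
      by (rule order_tendstoD(2))
    then have "eventually (\<lambda>m. c m y \<in> near x s) sequentially"
    proof eventually_elim
      case (elim m)
      have "eventually (\<lambda>j. norm (c j x - h - y) \<le> (s + t) / 2) sequentially"
        using s by (intro asymptotic_sublevelD[OF y(2)]) auto
      then have "eventually (\<lambda>j. norm (c (j + m) x - h - c m y) \<le> s) sequentially"
      proof eventually_elim
        case (elim j)
        have "norm (c (j + m) x - h - c m y) \<le> k m * norm (c j x - h - y) + e m y"
          using shift[OF x yA, of m j] by (simp add: add.commute)
        also have "\<dots> \<le> k m * ((s + t) / 2) + e m y"
          using elim k_nonneg[of m] by (intro add_right_mono mult_left_mono)
        finally show ?case using \<open>k m * ((s + t) / 2) + e m y < s\<close> by linarith
      qed
      then have "eventually (\<lambda>n. norm (c n x - h - c m y) \<le> s) sequentially"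
        by (rule eventually_sequentially_seg[of "\<lambda>n. norm (c n x - h - c m y) \<le> s" m, THEN iffD1])
      then show ?case by (rule asymptotic_sublevelI)
    qed
    then have "eventually (\<lambda>i. c (r i) y \<in> near x s) sequentially"
      by (rule eventually_subseq[OF r])
    then show "z \<in> near x s"
      by (rule weak_limit_in_closed_convex[OF w convex_asymptotic_sublevel closed_asymptotic_sublevel])
  qed
  moreover have "closed (K \<inter> near x t)" "convex (K \<inter> near x t)" "K \<inter> near x t \<subseteq> A"
    using K closed_asymptotic_sublevel convex_asymptotic_sublevel
    unfolding orbit_stable_def by (blast intro: convex_Int closed_Int)+
  ultimately show ?thesis
    using K ne unfolding orbit_stable_def by (meson Int_iff)
qed

text \<open>By minimality, each set \<open>K \<inter> near x t\<close> is empty or all of \<open>K\<close>, so the asymptotic gap to the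
  orbit of \<open>x\<close> cannot vary on \<open>K\<close>.\<close>

lemma minimal_stable_constant_radius:
  assumes K: "minimal_stable K" and x: "x \<in> A"
  shows "\<exists>\<rho>. \<forall>y\<in>K. \<forall>t. y \<in> near x t \<longleftrightarrow> \<rho> \<le> t"
proof -
  have st: "orbit_stable K" and min: "\<And>K'. orbit_stable K' \<Longrightarrow> K' \<subseteq> K \<Longrightarrow> K' = K"
    using K by (auto simp: minimal_stable_def)
  define S where "S = {t. K \<inter> near x t \<noteq> {}}"
  define \<rho> where "\<rho> = Inf S"
  obtain y0 where y0: "y0 \<in> K" using st by (auto simp: orbit_stable_def)
  have all: "K \<subseteq> near x t" if "t \<in> S" for t
    using min[OF orbit_stable_Int_near[OF st x]] that by (auto simp: S_def)
  have "S \<noteq> {}"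
  proof -
    obtain M where M: "\<And>a. a \<in> A \<Longrightarrow> norm a \<le> M" using A(2) by (auto simp: bounded_iff)
    have "norm (c n x - h - y0) \<le> M + norm h + norm y0" for n
      using norm_triangle_ineq4[of "c n x - h" y0] norm_triangle_ineq4[of "c n x" h] M[OF c_in[OF x, of n]]
      by linarith
    then have "y0 \<in> near x (M + norm h + norm y0)" by (intro asymptotic_sublevelI) simp
    then show ?thesis using y0 by (auto simp: S_def)
  qed
  have "bdd_below S"
    using asymptotic_sublevel_nonneg by (intro bdd_belowI[of _ 0]) (auto simp: S_def)
  have above: "K \<subseteq> near x t" if t: "\<rho> < t" for t
  proof -
    obtain t' where "t' \<in> S" "t' < t" using cInf_lessD[OF \<open>S \<noteq> {}\<close>, of t] t by (auto simp: \<rho>_def)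
    then show ?thesis using all[of t'] asymptotic_sublevel_mono[of t' t] by fastforce
  qed
  have "y \<in> near x \<rho>" if "y \<in> K" for y
    by (rule asymptotic_sublevel_right_continuous) (use above that in blast)
  moreover have "\<rho> \<le> t" if "y \<in> K" "y \<in> near x t" for y t
    unfolding \<rho>_def using that \<open>bdd_below S\<close> by (intro cInf_lower) (auto simp: S_def)
  ultimately show ?thesis
    using asymptotic_sublevel_mono[of \<rho> _ "\<lambda>n. c n x - h"] by (intro exI[of _ \<rho>]) blast
qed

text \<open>A separated subsequence of an orbit has a weak limit \<open>z\<close> in \<open>K\<close>, and by the UKK property \<open>z\<close>
  is closer to late points \<open>c m x\<close> than the radius \<open>\<rho>\<close>, by a fixed factor. This contradicts the
  constancy of the radius at \<open>z\<close>. Here the orbit of \<open>x\<close> is measured from its own points, which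
  need not lie in \<open>K\<close>; \<open>shift\<close> bounds these distances in terms of \<open>\<rho>\<close>.\<close>

lemma minimal_stable_no_separated_subsequence:
  fixes r :: "nat \<Rightarrow> nat"
  assumes K: "minimal_stable K" and x: "x \<in> K" and \<rho>: "\<forall>y\<in>K. \<forall>t. y \<in> near x t \<longleftrightarrow> \<rho> \<le> t"
    and pos: "0 < \<rho>" and r: "strict_mono r" and \<epsilon>: "0 < \<epsilon>"
  shows "\<exists>m n. m \<noteq> n \<and> dist (c (r m) x) (c (r n) x) < \<epsilon>"
proof (rule ccontr)
  assume "\<nexists>m n. m \<noteq> n \<and> dist (c (r m) x) (c (r n) x) < \<epsilon>"
  then have sep: "\<epsilon> \<le> norm (c (r m) x - c (r n) x)" if "m \<noteq> n" for m n
    using that by (metis dist_norm not_less)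
  have st: "orbit_stable K" using K by (simp add: minimal_stable_def)
  then have xA: "x \<in> A" and KA: "K \<subseteq> A" using x by (auto simp: orbit_stable_def)
  have "bounded (range (\<lambda>i. c (r i) x))"
    using c_in[OF xA] by (intro bounded_subset[OF A(2)]) auto
  then obtain s z where s: "strict_mono s" and "weakly_converges ((\<lambda>i. c (r i) x) \<circ> s) z"
    using reflexive_weakly_convergent_subsequence[OF reflexive] by blast
  define q where "q = r \<circ> s"
  have q: "strict_mono q" unfolding q_def using r s by (rule strict_mono_o)
  have w: "weakly_converges (\<lambda>i. c (q i) x) z"
    using \<open>weakly_converges ((\<lambda>i. c (r i) x) \<circ> s) z\<close> by (simp add: q_def comp_def)
  have z: "z \<in> K" using st x q w unfolding orbit_stable_def by blast
  have qsep: "\<epsilon> \<le> norm (c (q m) x - c (q n) x)" if "m \<noteq> n" for m n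
    unfolding q_def comp_def using that strict_mono_eq[OF s] by (intro sep) auto
  obtain \<delta> where \<delta>: "0 < \<delta>" "\<delta> < 1" and drop:
    "\<And>(u :: nat \<Rightarrow> 'a) v R. 0 < R \<Longrightarrow> R \<le> \<rho> + 1 \<Longrightarrow> (\<And>n. norm (u n) \<le> R) \<Longrightarrow>
      weakly_converges u v \<Longrightarrow> (\<And>m n. m \<noteq> n \<Longrightarrow> \<epsilon> \<le> norm (u m - u n)) \<Longrightarrow> norm v \<le> (1 - \<delta>) * R"
    using UKK_weak_limit_norm_drop[OF ukk \<epsilon>, of "\<rho> + 1"] pos by auto
  \<comment> \<open>The radius \<open>R\<close> exceeds \<open>\<rho>\<close> so little that \<open>(1 - \<delta>) * R\<close> is still below \<open>\<rho>\<close>.\<close>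
  define \<eta> where "\<eta> = min 1 (\<delta> * \<rho> / 2)"
  define R where "R = \<rho> + \<eta>"
  have \<eta>: "0 < \<eta>" using \<delta> pos by (simp add: \<eta>_def)
  have R: "0 < R" "R \<le> \<rho> + 1" using \<eta> pos by (auto simp: R_def \<eta>_def)
  have small: "(1 - \<delta>) * R < \<rho>"
  proof -
    have "(1 - \<delta>) * R \<le> (1 - \<delta>) * (\<rho> + \<delta> * \<rho> / 2)"
      using \<delta> by (intro mult_left_mono) (auto simp: R_def \<eta>_def)
    also have "\<dots> = \<rho> - \<delta> * \<rho> * (1 + \<delta>) / 2" by (simp add: field_simps)
    also have "\<dots> < \<rho>" using \<delta> pos by simp
    finally show ?thesis .
  qed
  have "(\<lambda>m. k m * (\<rho> + \<eta> / 2) + e m x) \<longlonglongrightarrow> 1 * (\<rho> + \<eta> / 2) + 0"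
    by (intro tendsto_intros k_lim e_lim xA)
  moreover have "1 * (\<rho> + \<eta> / 2) + 0 < R" using \<eta> by (simp add: R_def)
  ultimately have "eventually (\<lambda>m. k m * (\<rho> + \<eta> / 2) + e m x < R) sequentially"
    by (rule order_tendstoD(2))
  then have "eventually (\<lambda>m. norm (c m x - h - z) \<le> (1 - \<delta>) * R) sequentially"
  proof eventually_elim
    case (elim m)
    have "eventually (\<lambda>j. norm (c j x - h - x) \<le> \<rho> + \<eta> / 2) sequentially"
      using \<rho>[rule_format, OF x, of \<rho>] \<eta> by (intro asymptotic_sublevelD[of _ _ \<rho>]) auto
    then obtain N where N: "\<And>j. N \<le> j \<Longrightarrow> norm (c j x - h - x) \<le> \<rho> + \<eta> / 2"
      by (auto simp: eventually_sequentially)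
    have bound: "norm (c n x - h - c m x) \<le> R" if "N + m \<le> n" for n
    proof -
      have "norm (c n x - h - c m x) \<le> k m * norm (c (n - m) x - h - x) + e m x"
        using shift[OF xA xA, of m "n - m"] that by simp
      also have "\<dots> \<le> k m * (\<rho> + \<eta> / 2) + e m x"
        using N[of "n - m"] that k_nonneg[of m] by (intro add_right_mono mult_left_mono) auto
      finally show ?thesis using elim by linarith
    qed
    let ?p = "\<lambda>i. q (i + (N + m))"
    have "norm (z - h - c m x) \<le> (1 - \<delta>) * R"
    proof (rule drop[OF R])
      show "norm (c (?p i) x - h - c m x) \<le> R" for i
        using bound[of "?p i"] strict_mono_imp_increasing[OF q, of "i + (N + m)"] by simp
      have "strict_mono (\<lambda>i. i + (N + m))" by (simp add: strict_mono_def)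
      then have "weakly_converges (\<lambda>i. c (?p i) x) z"
        using weakly_converges_subseq[OF w] by (simp add: comp_def)
      then show "weakly_converges (\<lambda>i. c (?p i) x - h - c m x) (z - h - c m x)"
        by (intro weakly_converges_diff_const)
      show "\<epsilon> \<le> norm ((c (?p i) x - h - c m x) - (c (?p j) x - h - c m x))" if "i \<noteq> j" for i j
        using qsep[of "i + (N + m)" "j + (N + m)"] that by simp
    qed
    then show ?case using gap_sym[of z "c m x"] z KA c_in[OF xA] by auto
  qed
  then have "z \<in> near x ((1 - \<delta>) * R)" by (rule asymptotic_sublevelI)
  then show False using \<rho>[rule_format, OF z] small by auto
qed

text \<open>Otherwise all subsequences of the orbit have norm limit points, and these lie in \<open>K\<close>. If the
  radius \<open>\<rho>\<close> exceeded \<open>norm h\<close>, then starting from limit points \<open>w 0, \<dots>, w (n - 1)\<close> one could pick a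
  limit point almost at distance \<open>\<rho>\<close> from their barycentre. As its distance to each \<open>w i\<close> is at most
  \<open>\<rho>\<close>, none of these distances can be much smaller. The resulting infinite sequence is separated,
  and orbit points near it form a separated subsequence.\<close>

lemma minimal_stable_radius_le:
  assumes K: "minimal_stable K" and x: "x \<in> K" and \<rho>: "\<forall>y\<in>K. \<forall>t. y \<in> near x t \<longleftrightarrow> \<rho> \<le> t"
  shows "\<rho> \<le> norm h"
proof (rule ccontr)
  assume "\<not> \<rho> \<le> norm h"
  then have big: "norm h < \<rho>" by simp
  then have pos: "0 < \<rho>" using norm_ge_zero[of h] by linarith
  note nosep = minimal_stable_no_separated_subsequence[OF K x \<rho> pos]
  have st: "orbit_stable K" using K by (simp add: minimal_stable_def)
  then have convK: "convex K" by (simp add: orbit_stable_def)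
  define E where "E = {w. \<exists>s. strict_mono s \<and> (\<lambda>i. c (s i) x) \<longlonglongrightarrow> w}"
  have EK: "w \<in> K" if "w \<in> E" for w
    using that st x tendsto_imp_weakly_converges unfolding E_def orbit_stable_def by blast
  have upper: "norm (w - h - u) \<le> \<rho>" if w: "w \<in> E" and u: "u \<in> K" for w u
  proof (rule field_le_epsilon)
    fix \<eta> :: real assume \<eta>: "0 < \<eta>"
    obtain s where s: "strict_mono s" "(\<lambda>i. c (s i) x) \<longlonglongrightarrow> w" using w by (auto simp: E_def)
    have "eventually (\<lambda>n. norm (c n x - h - u) \<le> \<rho> + \<eta>) sequentially"
      using \<rho>[rule_format, OF u, of \<rho>] \<eta> by (intro asymptotic_sublevelD[of _ _ \<rho>]) auto
    then have "eventually (\<lambda>i. norm (c (s i) x - h - u) \<le> \<rho> + \<eta>) sequentially"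
      by (rule eventually_subseq[OF s(1)])
    moreover have "(\<lambda>i. norm (c (s i) x - h - u)) \<longlonglongrightarrow> norm (w - h - u)"
      by (intro tendsto_intros s(2))
    ultimately show "norm (w - h - u) \<le> \<rho> + \<eta>" by (intro tendsto_upperbound) auto
  qed
  have lower: "\<exists>w\<in>E. \<rho> - \<eta> \<le> norm (w - h - u)" if u: "u \<in> K" and \<eta>: "0 < \<eta>" for u \<eta>
  proof -
    have "\<not> eventually (\<lambda>n. norm (c n x - h - u) \<le> \<rho> - \<eta>) sequentially"
      using \<rho>[rule_format, OF u, of "\<rho> - \<eta>"] \<eta> asymptotic_sublevelI[of "\<lambda>n. c n x - h" u "\<rho> - \<eta>"] by auto
    then have "infinite {n. \<rho> - \<eta> < norm (c n x - h - u)}"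
      by (simp add: cofinite_eq_sequentially[symmetric] eventually_cofinite not_le)
    then obtain r :: "nat \<Rightarrow> nat" where r: "strict_mono r" "\<And>n. \<rho> - \<eta> < norm (c (r n) x - h - u)"
      using infinite_enumerate by blast
    obtain s w where s: "strict_mono s" and w: "((\<lambda>n. c (r n) x) \<circ> s) \<longlonglongrightarrow> w"
    proof -
      have "\<exists>m n. m \<noteq> n \<and> dist (c (r (s m)) x) (c (r (s n)) x) < d"
        if "strict_mono s" "0 < d" for s :: "nat \<Rightarrow> nat" and d
        using nosep[OF strict_mono_o[OF r(1) that(1)] that(2)] by simp
      then show thesis
        using convergent_subsequence_if_no_separated[of "\<lambda>n. c (r n) x"] that by blast
    qed
    have "w \<in> E"
      using w strict_mono_o[OF r(1) s] by (auto simp: E_def comp_def)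
    moreover have "(\<lambda>i. norm (c (r (s i)) x - h - u)) \<longlonglongrightarrow> norm (w - h - u)"
      using w by (intro tendsto_intros) (simp add: comp_def)
    then have "\<rho> - \<eta> \<le> norm (w - h - u)"
      by (rule tendsto_lowerbound) (use r(2) in \<open>auto intro!: always_eventually less_imp_le\<close>)
    ultimately show ?thesis by blast
  qed
  define \<mu> where "\<mu> = (\<rho> + norm h) / 2"
  define P where "P w n v \<longleftrightarrow> v \<in> E \<and> (\<forall>m<n. \<mu> \<le> norm (v - h - w m))" for w :: "nat \<Rightarrow> 'a" and n v
  have "\<exists>w. \<forall>n. P w n (w n)"
  proof (rule dependent_wellorder_choice)
    show "P w n v = P w' n v" if "\<And>m. m < n \<Longrightarrow> w m = w' m" for v w w' n
      using that by (auto simp: P_def)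
    show "\<exists>v. P w n v" if w: "\<And>m. m < n \<Longrightarrow> P w m (w m)" for n w
    proof (cases "n = 0")
      case True
      then show ?thesis using lower[OF x, of 1] by (auto simp: P_def)
    next
      case False
      then have n: "0 < real n" by simp
      define u where "u = (\<Sum>m<n. (1 / real n) *\<^sub>R w m)"
      have wK: "w m \<in> K" if "m < n" for m using w[OF that] EK by (auto simp: P_def)
      have "u \<in> K"
        unfolding u_def using convK n wK by (intro convex_sum) auto
      then obtain v where v: "v \<in> E" "\<rho> - (\<rho> - \<mu>) / (2 * real n) \<le> norm (v - h - u)"
        using lower[of u "(\<rho> - \<mu>) / (2 * real n)"] n big by (auto simp: \<mu>_def)
      have "\<mu> \<le> norm (v - h - w m)" if m: "m < n" for m
      proof (rule ccontr)
        assume "\<not> \<mu> \<le> norm (v - h - w m)"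
        then have lt: "norm (v - h - w m) < \<mu>" by simp
        have "v - h - u = (\<Sum>i<n. (1 / real n) *\<^sub>R (v - h - w i))"
          using n by (simp add: u_def scaleR_diff_right sum_subtractf sum_constant_scaleR)
        then have "norm (v - h - u) \<le> (\<Sum>i<n. (1 / real n) * norm (v - h - w i))"
          by (simp add: sum_norm_le)
        also have "\<dots> = (1 / real n) * (\<Sum>i<n. norm (v - h - w i))"
          by (simp only: sum_distrib_left)
        also have "(\<Sum>i<n. norm (v - h - w i)) = norm (v - h - w m) + (\<Sum>i\<in>{..<n} - {m}. norm (v - h - w i))"
          using m by (intro sum.remove) auto
        also have "(1 / real n) * \<dots> \<le> (1 / real n) * (\<mu> + (\<Sum>i\<in>{..<n} - {m}. \<rho>))"
        proof (rule mult_left_mono)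
          have "(\<Sum>i\<in>{..<n} - {m}. norm (v - h - w i)) \<le> (\<Sum>i\<in>{..<n} - {m}. \<rho>)"
            by (rule sum_mono, rule upper[OF v(1) wK]) simp
          then show "norm (v - h - w m) + (\<Sum>i\<in>{..<n} - {m}. norm (v - h - w i))
              \<le> \<mu> + (\<Sum>i\<in>{..<n} - {m}. \<rho>)"
            using lt by linarith
        qed simp
        also have "(\<Sum>i\<in>{..<n} - {m}. \<rho>) = (real n - 1) * \<rho>"
          using m by (simp add: of_nat_diff)
        also have "(1 / real n) * (\<mu> + (real n - 1) * \<rho>) = \<rho> - (\<rho> - \<mu>) / real n"
          using n by (simp add: field_simps)
        finally have "(\<rho> - \<mu>) / real n \<le> (\<rho> - \<mu>) / (2 * real n)" using v(2) by linarith
        then show False using n big by (simp add: \<mu>_def field_simps)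
      qed
      then show ?thesis using v(1) by (auto simp: P_def)
    qed
  qed
  then obtain w where "\<forall>n. P w n (w n)" ..
  then have wE: "\<And>n. w n \<in> E" and wfar: "\<And>m n. m < n \<Longrightarrow> \<mu> \<le> norm (w n - h - w m)"
    by (simp_all add: P_def)
  define g where "g = (\<rho> - norm h) / 2"
  have g: "0 < g" using big by (simp add: g_def)
  have wsep: "g \<le> dist (w m) (w n)" if "m \<noteq> n" for m n
  proof -
    have "g \<le> dist (w n) (w m)" if "m < n" for m n
      using wfar[OF that] norm_triangle_ineq4[of "w n - w m" h]
      by (simp add: dist_norm g_def \<mu>_def algebra_simps)
    then show ?thesis using that by (metis dist_commute nat_neq_iff)
  qed
  have "\<exists>r. \<forall>n. dist (c (r n) x) (w n) < g / 4 \<and> r n < r (Suc n)"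
  proof (rule dependent_nat_choice)
    have close: "\<exists>i>N. dist (c i x) (w n) < g / 4" for n N
    proof -
      obtain s where s: "strict_mono s" "(\<lambda>i. c (s i) x) \<longlonglongrightarrow> w n" using wE[of n] by (auto simp: E_def)
      then have "eventually (\<lambda>i. dist (c (s i) x) (w n) < g / 4) sequentially"
        using g by (intro tendstoD) auto
      then obtain M where M: "\<forall>i\<ge>M. dist (c (s i) x) (w n) < g / 4"
        unfolding eventually_sequentially by blast
      have "dist (c (s (max M (Suc N))) x) (w n) < g / 4" using M by simp
      moreover have "N < s (max M (Suc N))"
        using strict_mono_imp_increasing[OF s(1), of "max M (Suc N)"] by simp
      ultimately show ?thesis by blast
    qed
    show "\<exists>i. dist (c i x) (w 0) < g / 4" using close[of 0 0] by blast
    show "\<exists>j. dist (c j x) (w (Suc n)) < g / 4 \<and> i < j" for i n using close[of i "Suc n"] by blast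
  qed
  then obtain r where "\<forall>n. dist (c (r n) x) (w n) < g / 4 \<and> r n < r (Suc n)" ..
  then have r: "\<And>n. dist (c (r n) x) (w n) < g / 4" "\<And>n. r n < r (Suc n)" by simp_all
  have far: "g / 2 \<le> dist (c (r m) x) (c (r n) x)" if "m \<noteq> n" for m n
  proof -
    have "g \<le> dist (w m) (w n)" by (rule wsep[OF that])
    also have "\<dots> \<le> dist (w m) (c (r m) x) + dist (c (r m) x) (c (r n) x) + dist (c (r n) x) (w n)"
      using dist_triangle[of "w m" "w n" "c (r m) x"] dist_triangle[of "c (r m) x" "w n" "c (r n) x"]
      by linarith
    finally show ?thesis using r(1)[of m] r(1)[of n] by (simp add: dist_commute)
  qed
  have "strict_mono r" using r(2) by (simp add: strict_mono_Suc_iff)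
  then obtain m n where mn: "m \<noteq> n" "dist (c (r m) x) (c (r n) x) < g / 2"
    using nosep[of r "g / 2"] g by auto
  show False using far[OF mn(1)] mn(2) by simp
qed

theorem exists_asymptotically_fixed_point:
  "\<exists>x\<in>A. \<forall>s>norm h. eventually (\<lambda>n. norm (c n x - h - x) \<le> s) sequentially"
proof -
  obtain K where K: "minimal_stable K" using exists_minimal_stable by blast
  then obtain x where x: "x \<in> K" "x \<in> A"
    unfolding minimal_stable_def orbit_stable_def by blast
  obtain \<rho> where \<rho>: "\<forall>y\<in>K. \<forall>t. y \<in> near x t \<longleftrightarrow> \<rho> \<le> t"
    using minimal_stable_constant_radius[OF K x(2)] by blast
  have "x \<in> near x (norm h)"
    using minimal_stable_radius_le[OF K x(1) \<rho>] \<rho> x(1) by blast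
  then show ?thesis using x(2) asymptotic_sublevelD by blast
qed

end

section \<open>Cyclic maps on proximal parallel pairs\<close>

lemma proximal_pair_translation_norm:
  fixes A B :: "'a::real_normed_vector set"
  assumes ne: "A \<noteq> {}" and B: "B = (\<lambda>a. a + h) ` A" and prox: "proximal_pair A B"
    and rect: "\<And>x y. x \<in> A \<Longrightarrow> y \<in> A \<Longrightarrow> norm (x + h - y) = norm (y + h - x)"
  shows "norm h = setdist A B"
proof (rule antisym)
  obtain a where a: "a \<in> A" using ne by blast
  then have "a + h \<in> B" using B by blast
  then obtain y where "y \<in> B" "norm (a - y) = setdist A B"
    using prox a unfolding proximal_pair_def by blast
  then obtain b where b: "b \<in> A" "norm (a - (b + h)) = setdist A B" using B by blast
  \<comment> \<open>By the rectangle property \<open>b - (a + h)\<close> has the same norm, and the average of both vectors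
    is \<open>- h\<close>.\<close>
  have "norm (b - (a + h)) = setdist A B"
    using b(2) rect[OF a b(1)] norm_minus_commute[of a "b + h"] norm_minus_commute[of b "a + h"]
    by simp
  moreover have "- (2 *\<^sub>R h) = (a - (b + h)) + (b - (a + h))" by (simp add: scaleR_2)
  then have "norm (- (2 *\<^sub>R h)) \<le> norm (a - (b + h)) + norm (b - (a + h))"
    by (metis norm_triangle_ineq)
  ultimately show "norm h \<le> setdist A B" using b(2) by simp
  have "setdist A B \<le> dist a (a + h)" using a \<open>a + h \<in> B\<close> by (rule setdist_le_dist)
  then show "setdist A B \<le> norm h" by (simp add: dist_norm)
qed

text \<open>The translation by \<open>h\<close> moves the odd iterates back to \<open>A\<close>. As \<open>T\<close> need not commute with this
  translation, the orbit of \<open>x\<close> and that of the proximal point \<open>x + h\<close> are both needed; the property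
  \<open>UC\<close> makes them asymptotic to each other, which is the error term \<open>e\<close> below. Which of them
  continues \<open>c j x\<close> depends on the parity of \<open>j\<close>.\<close>

lemma cyclic_map_asymptotic_orbits:
  fixes A B :: "'a::banach set" and T :: "'a \<Rightarrow> 'a"
  assumes nuc: "NUC_space TYPE('a)"
    and A: "A \<noteq> {}" "bounded A" "closed A" "convex A"
    and B: "B = (\<lambda>a. a + h) ` A"
    and rect: "\<And>x y. x \<in> A \<Longrightarrow> y \<in> A \<Longrightarrow> norm (x + h - y) = norm (y + h - x)"
    and norm_h: "norm h = setdist A B"
    and uc: "property_UC A B"
    and arn: "asymptotically_relatively_nonexpansive A B T"
    and TA: "T ` A \<subseteq> B" and TB: "T ` B \<subseteq> A"
  shows "\<exists>k e. asymptotic_orbits A (\<lambda>n x. (T ^^ n) x - (if even n then 0 else h)) h k e"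
proof -
  obtain k where k: "\<And>n. 1 \<le> k n" "k \<longlonglongrightarrow> 1" and T: "\<And>x y n. x \<in> A \<Longrightarrow> y \<in> B \<Longrightarrow>
      norm ((T ^^ n) x - (T ^^ n) y) \<le> k n * norm (x - y)"
    using arn unfolding asymptotically_relatively_nonexpansive_def by blast
  define a where "a n x = (T ^^ n) x - (if even n then 0 else h)" for n x
  define b where "b n x = (T ^^ n) (x + h) - (if even n then h else 0)" for n x
  have up: "x + h \<in> B" if "x \<in> A" for x using that B by blast
  have down: "x - h \<in> A" if "x \<in> B" for x using that B by auto
  have iter: "(x \<in> A \<longrightarrow> (T ^^ n) x \<in> (if even n then A else B)) \<and>
      (x \<in> B \<longrightarrow> (T ^^ n) x \<in> (if even n then B else A))" for n x
    using TA TB by (induction n) auto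
  have aA: "a n x \<in> A" if "x \<in> A" for n x using iter[of x n] that down by (auto simp: a_def)
  have bA: "b n x \<in> A" if "x \<in> A" for n x using iter[of "x + h" n] up[OF that] down by (auto simp: b_def)
  have gap_sym: "norm (x - h - y) = norm (y - h - x)" if "x \<in> A" "y \<in> A" for x y
    using rect[OF that] norm_minus_commute[of "y + h" x] norm_minus_commute[of "x + h" y]
    by (simp add: algebra_simps)
  have ab: "norm (a n x - h - b n y) \<le> k n * norm (x - h - y)" if x: "x \<in> A" and y: "y \<in> A" for n x y
  proof -
    have "norm (a n x - h - b n y) = norm ((T ^^ n) x - (T ^^ n) (y + h))"
    proof (cases "even n")
      case True
      then show ?thesis by (simp add: a_def b_def)
    next
      case False
      have "norm (a n x - h - b n y) = norm (b n y - h - a n x)" by (rule gap_sym[OF aA[OF x] bA[OF y]])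
      also have "b n y - h - a n x = - ((T ^^ n) x - (T ^^ n) (y + h))"
        using False by (simp add: a_def b_def)
      finally show ?thesis by (simp only: norm_minus_cancel)
    qed
    also have "\<dots> \<le> k n * norm (x - (y + h))" by (rule T[OF x up[OF y]])
    finally show ?thesis by (simp add: diff_diff_eq add.commute)
  qed
  have e_lim: "(\<lambda>m. norm (a m y - b m y)) \<longlonglongrightarrow> 0" if y: "y \<in> A" for y
  proof -
    have "(\<lambda>m. k m * norm h) \<longlonglongrightarrow> norm h" using tendsto_mult[OF k(2) tendsto_const] by simp
    then have "(\<lambda>m. norm (a m y - (b m y + h))) \<longlonglongrightarrow> norm h"
    proof (rule tendsto_sandwich[OF _ _ tendsto_const, rotated 2])
      show "eventually (\<lambda>m. norm h \<le> norm (a m y - (b m y + h))) sequentially"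
        using setdist_le_dist[OF aA[OF y] up[OF bA[OF y]]] by (simp add: norm_h dist_norm)
      show "eventually (\<lambda>m. norm (a m y - (b m y + h)) \<le> k m * norm h) sequentially"
        using ab[OF y y] by (simp add: diff_diff_eq add.commute)
    qed
    moreover have "(\<lambda>m. norm (b m y - (b m y + h))) \<longlonglongrightarrow> norm h" by simp
    moreover have "range (\<lambda>m. a m y) \<subseteq> A" "range (\<lambda>m. b m y) \<subseteq> A" "range (\<lambda>m. b m y + h) \<subseteq> B"
      using aA[OF y] bA[OF y] up by auto
    ultimately show ?thesis
      using uc[unfolded property_UC_def, rule_format, of "\<lambda>m. a m y" "\<lambda>m. b m y" "\<lambda>m. b m y + h"]
      by (simp add: norm_h)
  qed
  have shift: "norm (a (m + j) x - h - a m y) \<le> k m * norm (a j x - h - y) + norm (a m y - b m y)"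
    if x: "x \<in> A" and y: "y \<in> A" for m j x y
  proof (cases "even j")
    case True
    then have "a (m + j) x = a m (a j x)" by (simp add: a_def funpow_add)
    moreover have "norm (a m (a j x) - h - a m y)
        \<le> norm (a m (a j x) - h - b m y) + norm (b m y - a m y)"
      using norm_triangle_ineq[of "a m (a j x) - h - b m y" "b m y - a m y"] by simp
    ultimately show ?thesis using ab[OF aA[OF x] y] by (simp add: norm_minus_commute) (metis add_right_mono order.trans)
  next
    case False
    then have "a (m + j) x = b m (a j x)" by (auto simp: a_def b_def funpow_add)
    then have "norm (a (m + j) x - h - a m y) = norm (a m y - h - b m (a j x))"
      using gap_sym[OF bA[OF aA[OF x]] aA[OF y]] by simp
    also have "\<dots> \<le> k m * norm (y - h - a j x)" by (rule ab[OF y aA[OF x]])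
    also have "norm (y - h - a j x) = norm (a j x - h - y)" by (rule gap_sym[OF y aA[OF x]])
    finally show ?thesis by (simp add: add_increasing2)
  qed
  have "asymptotic_orbits A a h k (\<lambda>m y. norm (a m y - b m y))"
  proof
    show "0 \<le> k m" for m using k(1)[of m] by linarith
  qed (use nuc A aA gap_sym shift k(2) e_lim in auto)
  then show ?thesis unfolding a_def by blast
qed

theorem theorem3p1:
  fixes A B :: "'a::banach set" and T :: "'a \<Rightarrow> 'a"
  assumes "NUC_space TYPE('a)"
    and "A \<noteq> {}" "bounded A" "closed A" "convex A"
    and "B \<noteq> {}" "bounded B" "closed B" "convex B"
    and "proximal_parallel_pair A B"
    and "rectangle_property A B"
    and "property_UC A B"
    and "T ` (A \<union> B) \<subseteq> A \<union> B"
    and "continuous_on (A \<union> B) T"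
    and "asymptotically_relatively_nonexpansive A B T"
    and "T ` A \<subseteq> B" "T ` B \<subseteq> A"
  shows "\<exists>x \<in> A \<union> B. norm (x - T x) = setdist A B"
proof -
  obtain h where B: "B = (\<lambda>a. a + h) ` A"
    and rect: "\<And>x y. x \<in> A \<Longrightarrow> y \<in> A \<Longrightarrow> norm (x + h - y) = norm (y + h - x)"
    using assms(11) unfolding rectangle_property_def by blast
  have "proximal_pair A B"
    using assms(10) by (simp add: proximal_parallel_pair_def sharp_proximal_pair_def)
  then have norm_h: "norm h = setdist A B"
    by (rule proximal_pair_translation_norm[OF assms(2) B _ rect])
  define c where "c n x = (T ^^ n) x - (if even n then 0 else h)" for n x
  obtain k e where "asymptotic_orbits A c h k e"
    using cyclic_map_asymptotic_orbits[OF assms(1-5) B rect norm_h assms(12,15-17)]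
    unfolding c_def by blast
  then interpret asymptotic_orbits A c h k e .
  obtain x where x: "x \<in> A"
    and near: "\<And>s. norm h < s \<Longrightarrow> eventually (\<lambda>n. norm (c n x - h - x) \<le> s) sequentially"
    using exists_asymptotically_fixed_point by blast
  have xB: "x + h \<in> B" using x B by blast
  have "(\<lambda>n. norm (c n x - (x + h))) \<longlonglongrightarrow> norm h"
  proof (rule order_tendstoI)
    fix s assume "s < norm h"
    then show "eventually (\<lambda>n. s < norm (c n x - (x + h))) sequentially"
      using setdist_le_dist[OF c_in[OF x] xB] by (intro always_eventually allI)
        (metis dist_norm norm_h order_less_le_trans)
  next
    fix s assume "norm h < s"
    then show "eventually (\<lambda>n. norm (c n x - (x + h)) < s) sequentially"
      using near[of "(norm h + s) / 2"] by (auto elim!: eventually_mono simp: diff_diff_eq add.commute)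
  qed
  moreover have "range (\<lambda>n. c n x) \<subseteq> A" using c_in[OF x] by auto
  ultimately have "(\<lambda>n. norm (c n x - x)) \<longlonglongrightarrow> 0"
    using assms(12)[unfolded property_UC_def, rule_format, of "\<lambda>n. c n x" "\<lambda>_. x" "\<lambda>_. x + h"] x xB
    by (simp add: norm_h)
  \<comment> \<open>\<open>T\<close> carries the even terms of this sequence to the odd ones, up to the translation by \<open>h\<close>.\<close>
  then have lim: "(\<lambda>n. c n x) \<longlonglongrightarrow> x" by (simp add: tendsto_norm_zero_iff LIM_zero_iff)
  have even_lim: "(\<lambda>n. c (2 * n) x) \<longlonglongrightarrow> x" and odd_lim: "(\<lambda>n. c (2 * n + 1) x) \<longlonglongrightarrow> x"
    using LIMSEQ_subseq_LIMSEQ[OF lim, of "\<lambda>n. 2 * n"] LIMSEQ_subseq_LIMSEQ[OF lim, of "\<lambda>n. 2 * n + 1"]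
    by (auto simp: strict_mono_def comp_def)
  have "(\<lambda>n. T (c (2 * n) x)) \<longlonglongrightarrow> T x"
    using c_in[OF x] x by (intro continuous_on_tendsto_compose[OF assms(14) even_lim]) auto
  moreover have "T (c (2 * n) x) = c (2 * n + 1) x + h" for n by (simp add: c_def)
  ultimately have "(\<lambda>n. c (2 * n + 1) x + h) \<longlonglongrightarrow> T x" by simp
  moreover have "(\<lambda>n. c (2 * n + 1) x + h) \<longlonglongrightarrow> x + h" by (intro tendsto_intros odd_lim)
  ultimately have "T x = x + h" by (rule LIMSEQ_unique)
  then have "norm (x - T x) = setdist A B" using norm_h by simp
  then show ?thesis using x by blast
qed

end
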